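(* Let $p\ge 7$ be a prime, and let $A'_{p-1}=\sum_{k=0}^{p-1}\binom{p-1}{k}^2\binom{p-1+k}{k}$. Then $$A'_{p-1}\equiv 1+p^3\left(\frac{10}{3}B_{p-3}-\frac{5}{4}B_{2p-4}\right)+\frac{5}{18}p^4B_{p-3}\pmod{p^5}.$$
   Context: The Bernoulli numbers $B_n$ are defined by $\frac{x}{e^x-1}=\sum_{n=0}^{\infty}B_n\frac{x^n}{n!}$. For rational numbers $a,b$ whose denominators are prime to $p$, $a\equiv b\pmod{p^m}$ means that $a-b$ equals $p^m$ times a rational number with denominator prime to $p$. *)

theory Defs
  imports "HOL-Computational_Algebra.Computational_Algebra" "HOL-Number_Theory.Number_Theory"
begin

definition bernoulli :: "nat \<Rightarrow> rat" where
  "bernoulli n = fact n * fps_nth (fps_X / (fps_exp 1 - 1)) n"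

definition rat_cong_pow :: "rat \<Rightarrow> rat \<Rightarrow> nat \<Rightarrow> nat \<Rightarrow> bool" where
  "rat_cong_pow a b p m \<longleftrightarrow>
     (\<exists>c::rat. a - b = of_nat p ^ m * c \<and> coprime (snd (quotient_of c)) (int p))"

end

theory Submission
  imports Defs
begin

text \<open>
  By Vandermonde's identity, \<open>A'\<^sub>n = (\<Sum>k\<le>n. (-1)^(n+k) * C(n,k) * C(n+k,k)^2)\<close>. For \<open>n = p - 1\<close> every term with
  \<open>k > 0\<close> carries the factor \<open>p^2/(p+k)^2\<close>, so \<open>A' = 1 + p^2 T\<close> and only \<open>T\<close> modulo \<open>p^3\<close> matters. Write
  \<open>H\<^sub>r = (\<Sum>k<p. 1/k^r)\<close>. Expanding \<open>T\<close> in powers of \<open>p\<close>, its only unknown term is the sum of \<open>H\<^sub>1(k)/k^2\<close>, and the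
  identity \<open>(\<Sum>k=1..n. (-1)^(k-1) * C(n,k)/k^2) = (H\<^sub>1(n)^2 + H\<^sub>2(n))/2\<close> at \<open>n = p - 1\<close>, expanded modulo \<open>p^3\<close>,
  evaluates it. The remaining weight-four sums vanish modulo \<open>p\<close>, and \<open>T\<close> is congruent to \<open>5/2 H\<^sub>2\<close> modulo \<open>p^3\<close>.

  For \<open>H\<^sub>2\<close> let \<open>P(m) = (\<Sum>k<p. k^m)\<close> and \<open>n\<^sub>j = p - 3 + j(p - 1)\<close>. Since \<open>k^(p-1) - 1\<close> is divisible by \<open>p\<close>, its cube shows that
  \<open>H\<^sub>2\<close> is congruent to \<open>P(n\<^sub>2) - 3 P(n\<^sub>1) + 3 P(n\<^sub>0)\<close> modulo \<open>p^3\<close>. A second order Kummer congruence for \<open>P(n)/n\<close>, obtained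
  from Voronoi's argument with multiplier 2, eliminates \<open>P(n\<^sub>2)\<close>, and \<open>P(n\<^sub>j)\<close> is congruent to \<open>p B(n\<^sub>j)\<close> modulo \<open>p^3\<close>.
\<close>

subsection \<open>The ideals generated by powers of p in the localization at p\<close>

text \<open>This is p^n Z_(p) inside the rationals, phrased with \<open>quotient_of\<close> so that
  \<open>rat_cong_pow\<close> unfolds to membership directly.\<close>

definition p_ideal :: "nat \<Rightarrow> nat \<Rightarrow> rat set" where
  "p_ideal p n = {x. \<exists>c. x = of_nat p ^ n * c \<and> coprime (snd (quotient_of c)) (int p)}"

lemma rat_cong_pow_iff: "rat_cong_pow a b p m \<longleftrightarrow> a - b \<in> p_ideal p m"
  by (simp add: rat_cong_pow_def p_ideal_def)

text \<open>Lowest terms may be forgotten: the reduced denominator divides every other denominator,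
  so it inherits being prime to p. The closure rules can then work with arbitrary fractions.\<close>

lemma p_ideal_iff:
  assumes "prime p"
  shows "x \<in> p_ideal p n \<longleftrightarrow>
    (\<exists>a b. coprime b (int p) \<and> x = of_nat p ^ n * (of_int a / of_int b))"
proof
  assume "x \<in> p_ideal p n"
  then obtain c where c: "x = of_nat p ^ n * c" "coprime (snd (quotient_of c)) (int p)"
    by (auto simp: p_ideal_def)
  have "c = of_int (fst (quotient_of c)) / of_int (snd (quotient_of c))"
    by (intro quotient_of_div) simp
  with c show "\<exists>a b. coprime b (int p) \<and> x = of_nat p ^ n * (of_int a / of_int b)"
    by metis
next
  assume "\<exists>a b. coprime b (int p) \<and> x = of_nat p ^ n * (of_int a / of_int b)"
  then obtain a b where ab: "coprime b (int p)" "x = of_nat p ^ n * (of_int a / of_int b)"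
    by blast
  have b0: "b \<noteq> 0" using ab(1) assms prime_gt_1_nat[OF assms] by auto
  define c where "c = (of_int a / of_int b :: rat)"
  define u v where "u = fst (quotient_of c)" and "v = snd (quotient_of c)"
  have q: "quotient_of c = (u, v)" by (simp add: u_def v_def)
  have v0: "v > 0" and cop: "coprime u v"
    using quotient_of_denom_pos[OF q] quotient_of_coprime[OF q] by auto
  have "of_int a / of_int b = (of_int u / of_int v :: rat)"
    using quotient_of_div[OF q] by (simp add: c_def)
  then have "(of_int (a * v) :: rat) = of_int (u * b)"
    using b0 v0 by (simp add: field_simps)
  then have "a * v = u * b" by (simp only: of_int_eq_iff)
  then have "v dvd u * b" by (metis dvd_triv_right)
  then have "v dvd b" using cop by (metis coprime_commute coprime_dvd_mult_right_iff)
  then have "coprime v (int p)" using ab(1) coprime_divisors dvd_refl by blast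
  then show "x \<in> p_ideal p n"
    using ab(2) unfolding p_ideal_def mem_Collect_eq v_def c_def by blast
qed

locale p_adic =
  fixes p :: nat
  assumes p_prime: "prime p"
begin

abbreviation I :: "nat \<Rightarrow> rat set" where "I \<equiv> p_ideal p"

lemma p_ideal_0: "0 \<in> I n"
  unfolding p_ideal_iff[OF p_prime] by (rule exI[of _ 0], rule exI[of _ 1]) auto

lemma of_int_p_ideal: "of_int a \<in> I 0"
  unfolding p_ideal_iff[OF p_prime] by (rule exI[of _ a], rule exI[of _ 1]) auto

lemma of_nat_p_ideal: "of_nat a \<in> I 0"
  using of_int_p_ideal[of "int a"] by simp

lemma one_p_ideal: "1 \<in> I 0"
  using of_int_p_ideal[of 1] by simp

lemma numeral_p_ideal: "numeral a \<in> I 0"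
  using of_int_p_ideal[of "numeral a"] by simp

lemma of_int_p_ideal_1_iff: "of_int a \<in> I 1 \<longleftrightarrow> int p dvd a"
proof
  assume "of_int a \<in> I 1"
  then obtain c b where cb: "coprime b (int p)" "of_int a = (of_nat p * (of_int c / of_int b) :: rat)"
    unfolding p_ideal_iff[OF p_prime] by auto
  have b0: "b \<noteq> 0" using cb(1) prime_gt_1_nat[OF p_prime] by auto
  have "(of_int (a * b) :: rat) = of_int (int p * c)"
    using cb(2) b0 by (simp add: field_simps)
  then have "a * b = int p * c" by (simp only: of_int_eq_iff)
  then have "int p dvd a * b" by simp
  then show "int p dvd a" using cb(1) by (metis coprime_commute coprime_dvd_mult_left_iff)
next
  assume "int p dvd a"
  then obtain c where "a = int p * c" by blast
  then show "of_int a \<in> I 1" unfolding p_ideal_iff[OF p_prime]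
    by (intro exI[of _ c] exI[of _ 1]) auto
qed

lemma p_ideal_add:
  assumes "x \<in> I n" "y \<in> I n" shows "x + y \<in> I n"
proof -
  obtain a b c d where ab: "coprime b (int p)" "x = of_nat p ^ n * (of_int a / of_int b)"
    and cd: "coprime d (int p)" "y = of_nat p ^ n * (of_int c / of_int d)"
    using assms unfolding p_ideal_iff[OF p_prime] by blast
  have "b \<noteq> 0" "d \<noteq> 0" using ab(1) cd(1) prime_gt_1_nat[OF p_prime] by auto
  then have "x + y = of_nat p ^ n * (of_int (a * d + c * b) / of_int (b * d))"
    unfolding ab(2) cd(2) by (simp add: field_simps)
  moreover have "coprime (b * d) (int p)" using ab(1) cd(1) by simp
  ultimately show ?thesis unfolding p_ideal_iff[OF p_prime] by blast
qed

lemma p_ideal_mult: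
  assumes "x \<in> I m" "y \<in> I n" shows "x * y \<in> I (m + n)"
proof -
  obtain a b c d where ab: "coprime b (int p)" "x = of_nat p ^ m * (of_int a / of_int b)"
    and cd: "coprime d (int p)" "y = of_nat p ^ n * (of_int c / of_int d)"
    using assms unfolding p_ideal_iff[OF p_prime] by blast
  have "x * y = of_nat p ^ (m + n) * (of_int (a * c) / of_int (b * d))"
    unfolding ab(2) cd(2) by (simp add: power_add)
  moreover have "coprime (b * d) (int p)" using ab(1) cd(1) by simp
  ultimately show ?thesis unfolding p_ideal_iff[OF p_prime] by blast
qed

lemma p_ideal_mult_left: "x \<in> I 0 \<Longrightarrow> y \<in> I n \<Longrightarrow> x * y \<in> I n"
  using p_ideal_mult[of x 0 y n] by simp

lemma p_ideal_mult_right: "x \<in> I n \<Longrightarrow> y \<in> I 0 \<Longrightarrow> x * y \<in> I n"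
  using p_ideal_mult[of x n y 0] by simp

lemma p_ideal_uminus: "x \<in> I n \<Longrightarrow> - x \<in> I n"
  using p_ideal_mult_left[OF of_int_p_ideal[of "-1"], of x n] by simp

lemma p_ideal_diff: "x \<in> I n \<Longrightarrow> y \<in> I n \<Longrightarrow> x - y \<in> I n"
  using p_ideal_add[of x n "-y"] p_ideal_uminus[of y n] by simp

lemma p_ideal_sum: "(\<And>k. k \<in> A \<Longrightarrow> f k \<in> I n) \<Longrightarrow> sum f A \<in> I n"
  by (induction A rule: infinite_finite_induct) (auto simp: p_ideal_0 p_ideal_add)

lemma p_ideal_power: "x \<in> I 0 \<Longrightarrow> x ^ k \<in> I 0"
  by (induction k) (auto simp: one_p_ideal p_ideal_mult_left)

lemma p_power_p_ideal: "of_nat p ^ n \<in> I n"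
  unfolding p_ideal_iff[OF p_prime] by (intro exI[of _ 1]) auto

lemma p_p_ideal: "of_nat p \<in> I 1"
  using p_power_p_ideal[of 1] by simp

lemma p_ideal_antimono:
  assumes "x \<in> I n" "m \<le> n" shows "x \<in> I m"
proof -
  obtain a b where ab: "coprime b (int p)" "x = of_nat p ^ n * (of_int a / of_int b)"
    using assms unfolding p_ideal_iff[OF p_prime] by blast
  have "x = of_nat p ^ m * (of_int (a * int p ^ (n - m)) / of_int b)"
    using assms(2) unfolding ab(2) by (simp flip: power_add)
  with ab(1) show ?thesis unfolding p_ideal_iff[OF p_prime] by blast
qed

lemma p_power_mult_p_ideal: "x \<in> I n \<Longrightarrow> of_nat p ^ m * x \<in> I (m + n)"
  by (intro p_ideal_mult p_power_p_ideal)

lemma inverse_of_int_p_ideal: "coprime b (int p) \<Longrightarrow> 1 / of_int b \<in> I 0"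
  unfolding p_ideal_iff[OF p_prime] by (rule exI[of _ 1], rule exI[of _ b]) auto

lemma inverse_of_nat_p_ideal: "\<not> p dvd b \<Longrightarrow> 1 / of_nat b \<in> I 0"
  using inverse_of_int_p_ideal[of "int b"] prime_imp_coprime_nat[OF p_prime, of b]
  by (simp add: coprime_commute)

lemma divide_of_nat_p_ideal: "\<not> p dvd b \<Longrightarrow> x \<in> I n \<Longrightarrow> x / of_nat b \<in> I n"
  using p_ideal_mult_right[OF _ inverse_of_nat_p_ideal, of x n b] by simp

text \<open>Integers prime to p are units of Z_(p). This later removes the factor 1 - 2^n that
  Voronoi's argument produces.\<close>

lemma p_ideal_cancel_unit:
  assumes "of_int a * x \<in> I n" "\<not> int p dvd a" shows "x \<in> I n"
proof -
  have c: "coprime a (int p)" 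
    using prime_imp_coprime[of "int p" a] assms(2) p_prime by (simp add: coprime_commute)
  have "a \<noteq> 0" using assms(2) by auto
  then have "x = 1 / of_int a * (of_int a * x)" by simp
  then show ?thesis using p_ideal_mult_left[OF inverse_of_int_p_ideal[OF c] assms(1)] by simp
qed

end

subsection \<open>Alternating binomial sums\<close>

text \<open>Up to the sign (-1)^n this is the n-th finite difference of \<open>f\<close> at
  0.\<close>

definition alt_binom_sum :: "(nat \<Rightarrow> 'a::comm_ring_1) \<Rightarrow> nat \<Rightarrow> 'a" where
  "alt_binom_sum f n = (\<Sum>k\<le>n. (-1) ^ k * of_nat (n choose k) * f k)"

lemma alt_binom_sum_0 [simp]: "alt_binom_sum f 0 = f 0"
  by (simp add: alt_binom_sum_def)

text \<open>Pascal's rule. It exhibits the sum as an iterated difference, which makes induction on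
  the order possible.\<close>

lemma alt_binom_sum_Suc:
  "alt_binom_sum f (Suc n) = alt_binom_sum f n - alt_binom_sum (\<lambda>k. f (Suc k)) n"
proof -
  have "alt_binom_sum f (Suc n) =
      f 0 + (\<Sum>k\<le>n. (-1) ^ Suc k * of_nat (Suc n choose Suc k) * f (Suc k))"
    unfolding alt_binom_sum_def by (subst sum.atMost_Suc_shift) simp
  also have "(\<Sum>k\<le>n. (-1) ^ Suc k * of_nat (Suc n choose Suc k) * f (Suc k)) =
      (\<Sum>k\<le>n. (-1) ^ Suc k * of_nat (n choose Suc k) * f (Suc k))
      - alt_binom_sum (\<lambda>k. f (Suc k)) n"
    unfolding alt_binom_sum_def sum_subtractf[symmetric]
    by (intro sum.cong refl) (simp add: algebra_simps)
  also have "f 0 + ((\<Sum>k\<le>n. (-1) ^ Suc k * of_nat (n choose Suc k) * f (Suc k))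
      - alt_binom_sum (\<lambda>k. f (Suc k)) n) =
      (\<Sum>k\<le>Suc n. (-1) ^ k * of_nat (n choose k) * f k) - alt_binom_sum (\<lambda>k. f (Suc k)) n"
    by (subst sum.atMost_Suc_shift) (simp add: algebra_simps)
  also have "(\<Sum>k\<le>Suc n. (-1) ^ k * of_nat (n choose k) * f k) = alt_binom_sum f n"
    by (simp add: alt_binom_sum_def binomial_eq_0)
  finally show ?thesis .
qed

lemma alt_binom_sum_const: "alt_binom_sum (\<lambda>_. c) n = (if n = 0 then c else 0)"
  by (induction n) (auto simp: alt_binom_sum_Suc)

text \<open>Each difference lowers the lower index by one, since C(x,s) - C(x+1,s) =
  -C(x,s-1).\<close>

lemma alt_binom_sum_choose:
  "m \<le> r \<Longrightarrow> (alt_binom_sum (\<lambda>k. of_nat ((x + k) choose r)) m :: 'a::comm_ring_1)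
     = (-1) ^ m * of_nat (x choose (r - m))"
proof (induction m arbitrary: x)
  case (Suc m)
  have "(alt_binom_sum (\<lambda>k. of_nat ((x + k) choose r)) (Suc m) :: 'a) =
      alt_binom_sum (\<lambda>k. of_nat ((x + k) choose r)) m
      - alt_binom_sum (\<lambda>k. of_nat ((Suc x + k) choose r)) m"
    by (simp add: alt_binom_sum_Suc)
  also have "\<dots> = (-1) ^ m * (of_nat (x choose (r - m)) - of_nat (Suc x choose (r - m)))"
    using Suc.prems Suc.IH[of x] Suc.IH[of "Suc x"] by (simp only: right_diff_distrib)
  also have "r - m = Suc (r - Suc m)" using Suc.prems by simp
  finally show ?case by (simp add: algebra_simps)
qed auto

text \<open>One of the two factors C(n+k,k) on the right is expanded by Vandermonde, the sums are
  swapped, and the inner sum over k collapses as a finite difference.\<close>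

lemma apery_sum_eq_alternating:
  "of_nat (\<Sum>k\<le>n. (n choose k)^2 * ((n + k) choose k)) =
     (-1) ^ n * (\<Sum>k\<le>n. (-1) ^ k * of_nat (n choose k) * of_nat ((n + k) choose k) ^ 2 :: 'a::comm_ring_1)"
proof -
  have inner: "(\<Sum>k\<le>n. (-1) ^ k * of_nat (n choose k) * of_nat ((n + k) choose k) * of_nat (k choose j))
      = ((-1) ^ n * of_nat (n choose j) * of_nat ((n + j) choose j) :: 'a)" (is "?L = _")
    if j: "j \<le> n" for j
  proof -
    have "?L = (\<Sum>k\<in>{j..n}. (-1) ^ k * of_nat (n choose k) * of_nat ((n + k) choose k) * of_nat (k choose j))"
      by (intro sum.mono_neutral_right) (auto simp: not_le binomial_eq_0)
    also have "\<dots> = (\<Sum>i\<in>{0..n-j}. (-1) ^ (i+j) * of_nat (n choose (i+j)) * of_nat ((n + (i+j)) choose (i+j)) * of_nat ((i+j) choose j))"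
      using j sum.shift_bounds_cl_nat_ivl[of _ 0 j "n - j"] by simp
    \<comment> \<open>With k = i + j, the revision C(n,k) C(k,j) = C(n,j) C(n-j,i) pulls C(n,j) out
      and leaves a difference of order n - j.\<close>
    also have "\<dots> = (\<Sum>i\<le>n-j. (-1) ^ j * of_nat (n choose j) *
        ((-1) ^ i * of_nat ((n - j) choose i) * of_nat (((n + j) + i) choose n)))"
    proof (intro sum.cong)
      fix i assume "i \<in> {..n-j}"
      then have i: "i + j \<le> n" using j by auto
      have "(n choose (i+j)) * ((i+j) choose j) = (n choose j) * ((n - j) choose i)"
        using choose_mult[of j "i+j" n] i by simp
      then have e: "(of_nat (n choose (i+j)) * of_nat ((i+j) choose j) :: 'a)
          = of_nat (n choose j) * of_nat ((n - j) choose i)"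
        by (metis of_nat_mult)
      have "(n + (i+j)) choose (i+j) = ((n + j) + i) choose n"
        using binomial_symmetric[of "i+j" "n + (i+j)"] by (simp add: add_ac)
      then have "(-1) ^ (i+j) * of_nat (n choose (i+j)) * of_nat ((n + (i+j)) choose (i+j)) * of_nat ((i+j) choose j)
        = ((-1) ^ (i+j) * (of_nat (n choose (i+j)) * of_nat ((i+j) choose j)) * of_nat (((n + j) + i) choose n) :: 'a)"
        by (simp add: mult_ac)
      then show "(-1) ^ (i+j) * of_nat (n choose (i+j)) * of_nat ((n + (i+j)) choose (i+j)) * of_nat ((i+j) choose j)
        = ((-1) ^ j * of_nat (n choose j) *
        ((-1) ^ i * of_nat ((n - j) choose i) * of_nat (((n + j) + i) choose n)) :: 'a)"
        unfolding e by (simp add: power_add mult_ac)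
    qed auto
    also have "\<dots> = (-1) ^ j * of_nat (n choose j) *
        alt_binom_sum (\<lambda>i. of_nat (((n + j) + i) choose n)) (n - j)"
      unfolding alt_binom_sum_def sum_distrib_left ..
    also have "\<dots> = (-1) ^ j * of_nat (n choose j) * ((-1) ^ (n - j) * of_nat ((n + j) choose j))"
      using j by (subst alt_binom_sum_choose) auto
    also have "\<dots> = (-1) ^ (j + (n - j)) * of_nat (n choose j) * of_nat ((n + j) choose j)"
      by (simp add: power_add mult_ac del: le_add_diff_inverse)
    finally show ?thesis using j by simp
  qed
  have vand: "(n + k) choose k = (\<Sum>j\<le>n. (n choose j) * (k choose j))" for k
  proof -
    have "(n + k) choose k = (k + n) choose n"
      using binomial_symmetric[of k "n + k"] by (simp add: add_ac)
    also have "\<dots> = (\<Sum>j\<le>n. (k choose j) * (n choose (n - j)))"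
      by (rule vandermonde[symmetric])
    also have "\<dots> = (\<Sum>j\<le>n. (n choose j) * (k choose j))"
      by (intro sum.cong refl) (metis atMost_iff binomial_symmetric mult.commute)
    finally show ?thesis .
  qed
  have "(\<Sum>k\<le>n. (-1) ^ k * of_nat (n choose k) * of_nat ((n + k) choose k) ^ 2 :: 'a)
     = (\<Sum>k\<le>n. \<Sum>j\<le>n. of_nat (n choose j) * ((-1) ^ k * of_nat (n choose k)
          * of_nat ((n + k) choose k) * of_nat (k choose j)))"
  proof (intro sum.cong refl)
    fix k
    have "(of_nat ((n + k) choose k) :: 'a) = (\<Sum>j\<le>n. of_nat (n choose j) * of_nat (k choose j))"
      by (subst vand) simp
    then have "(-1) ^ k * of_nat (n choose k) * of_nat ((n + k) choose k) ^ 2 =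
        (-1) ^ k * of_nat (n choose k) * of_nat ((n + k) choose k) *
          (\<Sum>j\<le>n. of_nat (n choose j) * of_nat (k choose j) :: 'a)"
      by (simp add: power2_eq_square mult_ac)
    then show "(-1) ^ k * of_nat (n choose k) * of_nat ((n + k) choose k) ^ 2 =
        (\<Sum>j\<le>n. of_nat (n choose j) * ((-1) ^ k * of_nat (n choose k)
          * of_nat ((n + k) choose k) * of_nat (k choose j)) :: 'a)"
      by (simp add: sum_distrib_left mult_ac)
  qed
  also have "\<dots> = (\<Sum>j\<le>n. of_nat (n choose j) * (\<Sum>k\<le>n. (-1) ^ k * of_nat (n choose k)
          * of_nat ((n + k) choose k) * of_nat (k choose j)))"
    unfolding sum_distrib_left by (rule sum.swap)
  also have "\<dots> = (\<Sum>j\<le>n. of_nat (n choose j) *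
        ((-1) ^ n * of_nat (n choose j) * of_nat ((n + j) choose j)))"
    by (intro sum.cong refl) (simp only: inner atMost_iff)
  also have "\<dots> = (-1) ^ n * of_nat (\<Sum>k\<le>n. (n choose k)^2 * ((n + k) choose k))"
    by (simp add: sum_distrib_left power2_eq_square mult_ac)
  finally show ?thesis
    by (simp flip: mult.assoc power_add)
qed

section \<open>Harmonic numbers and their alternating binomial sums\<close>

definition harm_sum :: "nat \<Rightarrow> nat \<Rightarrow> rat" where
  "harm_sum r n = (\<Sum>k=1..n. 1 / of_nat k ^ r)"

lemma harm_sum_0 [simp]: "harm_sum r 0 = 0"
  by (simp add: harm_sum_def)

lemma harm_sum_Suc: "harm_sum r (Suc n) = harm_sum r n + 1 / of_nat (Suc n) ^ r"
  by (simp add: harm_sum_def)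

text \<open>Absorption, (k+1) C(n+1,k+1) = (n+1) C(n,k), trades the division by k + 1 for one step
  in the order.\<close>

lemma alt_binom_sum_divide:
  fixes f :: "nat \<Rightarrow> rat"
  shows "alt_binom_sum (\<lambda>k. f (Suc k) / of_nat (Suc k)) n =
    (f 0 - alt_binom_sum f (Suc n)) / of_nat (Suc n)"
proof -
  have "alt_binom_sum f (Suc n) =
      f 0 + (\<Sum>k\<le>n. (-1) ^ Suc k * of_nat (Suc n choose Suc k) * f (Suc k))"
    unfolding alt_binom_sum_def by (subst sum.atMost_Suc_shift) simp
  also have "(\<Sum>k\<le>n. (-1) ^ Suc k * of_nat (Suc n choose Suc k) * f (Suc k)) =
      - of_nat (Suc n) * alt_binom_sum (\<lambda>k. f (Suc k) / of_nat (Suc k)) n"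
    unfolding alt_binom_sum_def sum_distrib_left
  proof (intro sum.cong refl)
    fix k
    have "(of_nat (Suc k * (Suc n choose Suc k)) :: rat) = of_nat (Suc n * (n choose k))"
      by (simp only: Suc_times_binomial_eq mult.commute)
    then have e: "(of_nat (Suc n choose Suc k) :: rat) = of_nat (Suc n) * of_nat (n choose k) / of_nat (Suc k)"
      by (simp only: of_nat_mult) (simp add: field_simps del: binomial_Suc_Suc of_nat_Suc)
    show "(-1) ^ Suc k * of_nat (Suc n choose Suc k) * f (Suc k) =
      - of_nat (Suc n) * ((-1) ^ k * of_nat (n choose k) * (f (Suc k) / of_nat (Suc k)))"
      unfolding e by (simp del: of_nat_Suc)
  qed
  finally show ?thesis by (simp add: field_simps)
qed

text \<open>Each further division by k becomes a summation over the order m. The term k = 0 on the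
  left contributes nothing because division by 0 yields 0.\<close>

lemma alt_binom_sum_divide_eq_sum:
  fixes f :: "nat \<Rightarrow> rat"
  shows "alt_binom_sum (\<lambda>k. f k / of_nat k) n =
    - (\<Sum>m=1..n. (f 0 - alt_binom_sum f m) / of_nat m)"
proof (induction n)
  case (Suc n)
  then show ?case
    by (subst alt_binom_sum_Suc, subst alt_binom_sum_divide) simp
qed simp

text \<open>Both sides are the complete homogeneous symmetric sum of degree 2 in 1, 1/2, ...,
  1/n.\<close>

lemma sum_harm_sum_1_divide:
  "(\<Sum>m=1..n. harm_sum 1 m / of_nat m) = (harm_sum 1 n ^ 2 + harm_sum 2 n) / 2"
proof (induction n)
  case (Suc n)
  show ?case
    unfolding sum.cl_ivl_Suc harm_sum_Suc using Suc
    by (simp add: power2_eq_square algebra_simps add_divide_distrib del: of_nat_Suc)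
qed simp

text \<open>The division rule applied twice to the constant 1: first it gives -H_1, then minus the
  sum of H_1(m)/m.\<close>

lemma alt_binom_sum_inverse_square:
  "alt_binom_sum (\<lambda>k. 1 / of_nat k ^ 2) n = - (harm_sum 1 n ^ 2 + harm_sum 2 n) / 2"
proof -
  have 1: "alt_binom_sum (\<lambda>k. 1 / of_nat k) n = - harm_sum 1 n" for n
  proof -
    have "alt_binom_sum (\<lambda>k. 1 / of_nat k) n = - (\<Sum>m=1..n. 1 / of_nat m :: rat)"
      using alt_binom_sum_divide_eq_sum[of "\<lambda>_. 1" n] by (simp add: alt_binom_sum_const)
    then show ?thesis by (simp add: harm_sum_def)
  qed
  have "alt_binom_sum (\<lambda>k. 1 / of_nat k ^ 2 :: rat) n = alt_binom_sum (\<lambda>k. (1 / of_nat k) / of_nat k) n"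
    by (simp add: power2_eq_square)
  also have "\<dots> = - (\<Sum>m=1..n. harm_sum 1 m / of_nat m)"
    by (subst alt_binom_sum_divide_eq_sum) (simp add: 1)
  finally show ?thesis unfolding sum_harm_sum_1_divide by (simp only: minus_divide_left)
qed

text \<open>One difference turns H_1 into 1/(k+1), to which absorption applies. At n = 0 both sides
  are 0, again by the convention for division.\<close>

lemma alt_binom_sum_harm_sum_1: "alt_binom_sum (harm_sum 1) n = - 1 / of_nat n"
proof (cases n)
  case (Suc m)
  have "alt_binom_sum (harm_sum 1) (Suc m) =
      - alt_binom_sum (\<lambda>k. harm_sum 1 (Suc k) - harm_sum 1 k) m"
    by (simp add: alt_binom_sum_Suc) (simp add: alt_binom_sum_def algebra_simps sum_subtractf)
  also have "(\<lambda>k. harm_sum 1 (Suc k) - harm_sum 1 k) = (\<lambda>k. 1 / of_nat (Suc k))"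
    by (simp add: harm_sum_Suc)
  finally show ?thesis
    using Suc alt_binom_sum_divide[of "\<lambda>_. 1" m] by (simp add: alt_binom_sum_const)
qed simp

text \<open>The numerator is the sum of H_1(m)/m up to k, whose alternating sum is -1/n^2; the two
  divisions by k turn this into -H_3 and then into the stated sum. It trades H_1^2 for sums linear
  in harmonic numbers.\<close>

lemma alt_binom_sum_nested:
  "alt_binom_sum (\<lambda>k. (harm_sum 1 k ^ 2 + harm_sum 2 k) / 2 / of_nat k ^ 2) n
     = - (\<Sum>m=1..n. harm_sum 3 m / of_nat m)"
proof -
  define a where "a = (\<lambda>k. (harm_sum 1 k ^ 2 + harm_sum 2 k) / 2)"
  have a0: "a 0 = 0" by (simp add: a_def)
  have aS: "a (Suc k) - a k = harm_sum 1 (Suc k) / of_nat (Suc k)" for k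
    unfolding a_def sum_harm_sum_1_divide[symmetric] by simp
  have 1: "alt_binom_sum a n = - 1 / of_nat n ^ 2" for n
  proof (cases n)
    case (Suc m)
    have "alt_binom_sum a (Suc m) = - alt_binom_sum (\<lambda>k. a (Suc k) - a k) m"
      by (simp add: alt_binom_sum_Suc) (simp add: alt_binom_sum_def algebra_simps sum_subtractf)
    then show ?thesis
      using Suc alt_binom_sum_divide[of "harm_sum 1" m] unfolding aS
      by (simp only: alt_binom_sum_harm_sum_1 power2_eq_square) simp
  qed (simp add: a0)
  have 2: "alt_binom_sum (\<lambda>k. a k / of_nat k) n = - harm_sum 3 n" for n
    by (subst alt_binom_sum_divide_eq_sum)
      (simp add: 1 a0 harm_sum_def power2_eq_square power3_eq_cube mult_ac)
  have "alt_binom_sum (\<lambda>k. a k / of_nat k ^ 2) n = alt_binom_sum (\<lambda>k. a k / of_nat k / of_nat k) n"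
    by (simp add: power2_eq_square)
  also have "\<dots> = - (\<Sum>m=1..n. harm_sum 3 m / of_nat m)"
    by (subst alt_binom_sum_divide_eq_sum) (simp add: 2 a0)
  finally show ?thesis by (simp add: a_def)
qed

subsection \<open>Bernoulli numbers and power sums\<close>

text \<open>Division of power series is a true quotient only if the divisor divides; here e^x - 1
  has order 1, the order of x.\<close>

lemma bernoulli_fps_mult: "fps_X / (fps_exp 1 - 1) * (fps_exp 1 - 1) = (fps_X :: rat fps)"
proof -
  have n1: "fps_nth (fps_exp 1 - 1 :: rat fps) 1 \<noteq> 0" by simp
  then have "fps_exp 1 - 1 \<noteq> (0 :: rat fps)" by (metis fps_zero_nth)
  moreover have "subdegree (fps_exp 1 - 1 :: rat fps) \<le> 1"
    using n1 by (rule subdegree_leI)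
  ultimately have "(fps_exp 1 - 1 :: rat fps) dvd fps_X"
    by (subst fps_dvd_iff) auto
  then show ?thesis by (rule dvd_div_mult_self)
qed

lemma fps_nth_bernoulli: "fps_nth (fps_X / (fps_exp 1 - 1)) n = bernoulli n / fact n"
  by (simp add: bernoulli_def)

definition power_sum :: "nat \<Rightarrow> nat \<Rightarrow> rat" where
  "power_sum n m = (\<Sum>k<n. of_nat k ^ m)"

text \<open>Faulhaber's formula: multiply the geometric sum of the series e^(kx) by x and compare
  coefficients of x^(m+1). The term i = m is n B_m.\<close>

lemma power_sum_bernoulli:
  "power_sum n m = (\<Sum>i\<le>m. of_nat (m choose i) * (bernoulli i * of_nat n ^ (m - i + 1) / of_nat (m - i + 1)))"
proof -
  let ?F = "fps_X / (fps_exp 1 - 1) :: rat fps"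
  have geo: "(\<Sum>k<n. fps_exp (of_nat k)) * (fps_exp 1 - 1) = fps_exp (of_nat n) - (1 :: rat fps)" for n
  proof (induction n)
    case (Suc n)
    have "fps_exp (of_nat (Suc n)) = (fps_exp (of_nat n) * fps_exp 1 :: rat fps)"
      by (simp add: fps_exp_add_mult)
    with Suc show ?case by (simp add: algebra_simps)
  qed simp
  have "fps_X * (\<Sum>k<n. fps_exp (of_nat k)) = ?F * (fps_exp (of_nat n) - 1)"
    unfolding geo[symmetric] by (subst (1) bernoulli_fps_mult[symmetric]) (simp only: mult_ac)
  then have "fps_nth (fps_X * (\<Sum>k<n. fps_exp (of_nat k))) (Suc m)
      = fps_nth (?F * (fps_exp (of_nat n) - 1)) (Suc m)" by simp
  also have "fps_nth (fps_X * (\<Sum>k<n. fps_exp (of_nat k))) (Suc m) = power_sum n m / fact m"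
    by (simp add: fps_sum_nth power_sum_def sum_divide_distrib)
  also have "fps_nth (?F * (fps_exp (of_nat n) - 1)) (Suc m) =
      (\<Sum>i\<le>m. bernoulli i / fact i * (of_nat n ^ (Suc m - i) / fact (Suc m - i)))"
  proof -
    have "fps_nth (?F * (fps_exp (of_nat n) - 1)) (Suc m) =
      (\<Sum>i\<le>Suc m. bernoulli i / fact i * fps_nth (fps_exp (of_nat n) - 1) (Suc m - i))"
      unfolding fps_mult_nth fps_nth_bernoulli atMost_atLeast0 ..
    \<comment> \<open>The top term i = m + 1 drops out because e^(nx) - 1 has no constant
      term.\<close>
    also have "\<dots> = (\<Sum>i\<le>m. bernoulli i / fact i * fps_nth (fps_exp (of_nat n) - 1) (Suc m - i))"
      unfolding sum.atMost_Suc by simp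
    also have "\<dots> = (\<Sum>i\<le>m. bernoulli i / fact i * (of_nat n ^ (Suc m - i) / fact (Suc m - i)))"
      by (intro sum.cong refl) (simp add: mult.commute)
    finally show ?thesis .
  qed
  finally have "power_sum n m = fact m *
      (\<Sum>i\<le>m. bernoulli i / fact i * (of_nat n ^ (Suc m - i) / fact (Suc m - i)))"
    by (simp only: nonzero_divide_eq_eq[OF fact_nonzero] mult.commute)
  also have "\<dots> = (\<Sum>i\<le>m. of_nat (m choose i) * (bernoulli i * of_nat n ^ (m - i + 1) / of_nat (m - i + 1)))"
    unfolding sum_distrib_left
  proof (intro sum.cong refl)
    fix i assume "i \<in> {..m}"
    then have i: "i \<le> m" by simp
    then have f: "fact (Suc m - i) = (of_nat (m - i + 1) * fact (m - i) :: rat)"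
      by (simp add: Suc_diff_le)
    have c: "(of_nat (m choose i) :: rat) = fact m / (fact i * fact (m - i))"
      using i by (rule binomial_fact)
    show "fact m * (bernoulli i / fact i * (of_nat n ^ (Suc m - i) / fact (Suc m - i))) =
        of_nat (m choose i) * (bernoulli i * of_nat n ^ (m - i + 1) / of_nat (m - i + 1))"
      unfolding f c using i by (simp add: Suc_diff_le del: of_nat_Suc)
  qed
  finally show ?thesis .
qed

text \<open>For F(x) = x/(e^x - 1) one has F(-x) = F(x) + x, so odd coefficients beyond the first
  are their own negatives.\<close>

lemma bernoulli_odd:
  assumes "odd n" "n \<noteq> 1"
  shows "bernoulli n = 0"
proof -
  let ?F = "fps_X / (fps_exp 1 - 1) :: rat fps"
  have nz: "fps_exp 1 - 1 \<noteq> (0 :: rat fps)"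
    using bernoulli_fps_mult by (metis fps_X_neq_zero mult_zero_right)
  have inv: "fps_exp 1 * fps_exp (-1) = (1 :: rat fps)"
    by (simp flip: fps_exp_add_mult)
  have "fps_compose (?F * (fps_exp 1 - 1)) (- fps_X) = fps_compose fps_X (- fps_X)"
    by (simp only: bernoulli_fps_mult)
  then have "fps_compose ?F (- fps_X) * (fps_exp (-1) - 1) = - fps_X"
    by (subst (asm) fps_compose_mult_distrib) (simp_all add: fps_compose_sub_distrib fps_exp_compose_linear)
  then have "fps_compose ?F (- fps_X) * (fps_exp (-1) - 1) * fps_exp 1 = - fps_X * fps_exp 1"
    by simp
  moreover have "(fps_exp (-1) - 1) * fps_exp 1 = (- (fps_exp 1 - 1) :: rat fps)"
    using inv by (simp add: algebra_simps)
  ultimately have "fps_compose ?F (- fps_X) * (fps_exp 1 - 1) = fps_X * fps_exp 1"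
    by (metis (no_types, lifting) minus_mult_left minus_mult_right mult.assoc neg_equal_iff_equal)
  also have "\<dots> = (?F + fps_X) * (fps_exp 1 - 1)"
    using bernoulli_fps_mult by (simp add: algebra_simps)
  finally have "fps_compose ?F (- fps_X) = ?F + fps_X" using nz by simp
  then have "(-1) ^ n * fps_nth ?F n = fps_nth (?F + fps_X) n"
    by (metis fps_compose_uminus' fps_nth_Abs_fps)
  then show ?thesis using assms by (simp add: fps_nth_bernoulli)
qed

section \<open>Power sums against Bernoulli numbers modulo powers of p\<close>

context p_adic
begin

lemmas p_ideal_intros =
  p_ideal_add p_ideal_diff p_ideal_uminus p_ideal_sum of_nat_p_ideal of_int_p_ideal
  one_p_ideal numeral_p_ideal p_ideal_power

text \<open>If e + 1 = p^t u with u prime to p, the size bound forces t <= e - s, so the division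
  costs at most e - s factors p.\<close>

lemma p_power_divide_Suc_p_ideal:
  assumes "s \<le> e" "e + 1 < p ^ (e - s + 1)"
  shows "of_nat p ^ e / of_nat (e + 1) \<in> I s"
proof -
  obtain t u where tu: "e + 1 = p ^ t * u" "\<not> p dvd u"
    using multiplicity_decompose'[of "e + 1" p] p_prime
    by (metis add_is_0 not_prime_unit one_neq_zero)
  have "u > 0" using tu(1) by (metis add_is_0 gr0I mult_0_right one_neq_zero)
  then have "p ^ t \<le> e + 1" using tu(1) by simp
  then have "p ^ t < p ^ (e - s + 1)" using assms(2) by linarith
  then have "t < e - s + 1" using prime_gt_1_nat[OF p_prime] power_less_imp_less_exp by blast
  then have t: "t \<le> e" "s \<le> e - t" using assms(1) by auto
  have "(of_nat p :: rat) ^ e = of_nat p ^ t * of_nat p ^ (e - t)"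
    using t(1) by (simp flip: power_add)
  then have "of_nat p ^ e / of_nat (e + 1) = (of_nat p ^ (e - t) * (1 / of_nat u) :: rat)"
    unfolding tu(1) using prime_gt_0_nat[OF p_prime] by simp
  moreover have "of_nat p ^ (e - t) * (1 / of_nat u) \<in> I (e - t)"
    by (intro p_ideal_mult_right p_power_p_ideal inverse_of_nat_p_ideal tu)
  ultimately show ?thesis using p_ideal_antimono t(2) by metis
qed

lemma power_sum_p_ideal: "power_sum n m \<in> I 0"
  unfolding power_sum_def by (intro p_ideal_intros)

text \<open>One factor p is attached to each B_i, because p B_i is p-integral while B_i need not
  be.\<close>

lemma power_sum_minus_bernoulli:
  "power_sum p n - of_nat p * bernoulli n =
     (\<Sum>i<n. of_nat (n choose i) * ((of_nat p * bernoulli i) * (of_nat p ^ (n - i) / of_nat (n - i + 1))))"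
  unfolding power_sum_bernoulli lessThan_Suc_atMost[symmetric] by (simp add: mult_ac)

text \<open>The integrality part of von Staudt-Clausen, by strong induction: in Faulhaber's formula
  all other terms are p-integral since p^e/(e+1) is.\<close>

lemma p_mult_bernoulli_p_ideal: "of_nat p * bernoulli n \<in> I 0"
proof (induction n rule: less_induct)
  case (less n)
  have "of_nat p * bernoulli n = power_sum p n - (power_sum p n - of_nat p * bernoulli n)"
    by simp
  also have "\<dots> \<in> I 0"
    unfolding power_sum_minus_bernoulli
  proof (intro p_ideal_diff p_ideal_sum p_ideal_mult_left[OF of_nat_p_ideal] power_sum_p_ideal)
    fix i assume i: "i \<in> {..<n}"
    then have B: "of_nat p * bernoulli i \<in> I 0" using less by simp
    have "2 ^ (n - i + 1) \<le> p ^ (n - i + 1)"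
      using prime_ge_2_nat[OF p_prime] by (rule power_mono) simp
    moreover have "n - i + 1 < 2 ^ (n - i + 1)" by (rule less_exp)
    ultimately have "of_nat p ^ (n - i) / of_nat (n - i + 1) \<in> I 0"
      by (intro p_power_divide_Suc_p_ideal) auto
    with B show "of_nat p * bernoulli i * (of_nat p ^ (n - i) / of_nat (n - i + 1)) \<in> I 0"
      by (rule p_ideal_mult_left)
  qed
  finally show ?case .
qed

lemma power_sum_cong_bernoulli_mod_p:
  assumes "p > 2"
  shows "power_sum p n - of_nat p * bernoulli n \<in> I 1"
  unfolding power_sum_minus_bernoulli
proof (intro p_ideal_sum p_ideal_mult_left[OF of_nat_p_ideal]
    p_ideal_mult_left[OF p_mult_bernoulli_p_ideal])
  fix i assume i: "i \<in> {..<n}"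
  define e where "e = n - i"
  have e: "e \<ge> 1" using i by (simp add: e_def)
  have "e + 1 < 3 ^ e" using e by (induction e rule: dec_induct) auto
  also have "3 ^ e \<le> p ^ e" using assms by (intro power_mono) auto
  finally show "of_nat p ^ (n - i) / of_nat (n - i + 1) \<in> I 1"
    using e unfolding e_def[symmetric] by (intro p_power_divide_Suc_p_ideal) auto
qed

text \<open>Let e = n - i. For e = 1 the Bernoulli number is zero; for e = 2 the factor p^2/3 gains
  a third p from p B_(n-2), which is congruent to the power sum assumed divisible by p; for e >= 3
  already p^e/(e+1) suffices.\<close>

lemma power_sum_cong_bernoulli_mod_p3:
  assumes "p \<ge> 7" "even n" "n \<ge> 4" "power_sum p (n - 2) \<in> I 1"
  shows "power_sum p n - of_nat p * bernoulli n \<in> I 3"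
  unfolding power_sum_minus_bernoulli
proof (intro p_ideal_sum p_ideal_mult_left[OF of_nat_p_ideal])
  fix i assume i: "i \<in> {..<n}"
  define e where "e = n - i"
  consider "i = n - 1" | "i = n - 2" | "e \<ge> 3" using i unfolding e_def by fastforce
  then show "of_nat p * bernoulli i * (of_nat p ^ (n - i) / of_nat (n - i + 1)) \<in> I 3"
  proof cases
    case 1
    then have "bernoulli i = 0" using assms by (intro bernoulli_odd) auto
    then show ?thesis by (simp add: p_ideal_0)
  next
    case 2
    have e: "n - i = 2" using 2 assms by simp
    have "of_nat p * bernoulli i =
        power_sum p i - (power_sum p i - of_nat p * bernoulli i)" by simp
    also have "\<dots> \<in> I 1"
      using assms 2 by (intro p_ideal_diff power_sum_cong_bernoulli_mod_p) auto
    finally have B: "of_nat p * bernoulli i \<in> I 1" .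
    have "of_nat p ^ 2 / of_nat (2 + 1) \<in> I 2"
      using assms(1) by (intro p_power_divide_Suc_p_ideal) auto
    then show ?thesis using p_ideal_mult[OF B] e by (metis (mono_tags) numeral_3_eq_3 numeral_2_eq_2 plus_1_eq_Suc)
  next
    case 3
    have "c + 3 + 1 < (7::nat) ^ (c + 1)" for c by (induction c) auto
    from this[of "e - 3"] have "e + 1 < 7 ^ (e - 3 + 1)" using 3 by simp
    also have "7 ^ (e - 3 + 1) \<le> p ^ (e - 3 + 1)" using assms by (intro power_mono) auto
    finally have "of_nat p ^ e / of_nat (e + 1) \<in> I 3"
      using 3 by (intro p_power_divide_Suc_p_ideal) auto
    then show ?thesis
      unfolding e_def by (intro p_ideal_mult_left p_mult_bernoulli_p_ideal)
  qed
qed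

section \<open>Voronoi's congruence with multiplier 2\<close>

lemma power_expansion_p3:
  assumes "p > 2" and x: "x \<in> I 0" and y: "y \<in> I 0"
  shows "(x - of_nat p * y) ^ (m + 2) - (x ^ (m + 2) - of_nat (m + 2) * (of_nat p * y * x ^ (m + 1))
     + of_nat (m + 2) * (of_nat (m + 1) / 2 * of_nat p ^ 2 * y ^ 2 * x ^ m)) \<in> I 3"
proof (induction m)
  case 0
  have "(x - of_nat p * y) ^ (0 + 2) - (x ^ (0 + 2) - of_nat (0 + 2) * (of_nat p * y * x ^ (0 + 1))
     + of_nat (0 + 2) * (of_nat (0 + 1) / 2 * of_nat p ^ 2 * y ^ 2 * x ^ 0)) = 0"
    by (simp add: power2_eq_square algebra_simps)
  then show ?case by (simp only: p_ideal_0)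
next
  case (Suc m)
  let ?E = "\<lambda>m. (x - of_nat p * y) ^ (m + 2) - (x ^ (m + 2) - of_nat (m + 2) * (of_nat p * y * x ^ (m + 1))
     + of_nat (m + 2) * (of_nat (m + 1) / 2 * of_nat p ^ 2 * y ^ 2 * x ^ m))"
  \<comment> \<open>Multiplying the expansion by x - p y reproduces the next one up to a single term
    of order p^3.\<close>
  have eq: "?E (Suc m) = (x - of_nat p * y) * ?E m
      - of_nat p ^ 3 * (of_nat (m + 2) * of_nat (m + 1) / of_nat 2 * (y ^ 3 * x ^ m))"
    by (simp add: field_simps power2_eq_square power3_eq_cube)
  have "\<not> p dvd 2" using assms(1) by (auto dest: dvd_imp_le)
  then have "of_nat p ^ 3 * (of_nat (m + 2) * of_nat (m + 1) / of_nat 2 * (y ^ 3 * x ^ m)) \<in> I 3"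
    by (intro p_ideal_mult_right p_power_p_ideal divide_of_nat_p_ideal p_ideal_mult_left p_ideal_intros x y)
  moreover have "x - of_nat p * y \<in> I 0"
    by (intro p_ideal_diff p_ideal_mult_left of_nat_p_ideal x y)
  ultimately show ?case
    unfolding eq using Suc by (blast intro: p_ideal_diff p_ideal_mult_left)
qed

text \<open>Doubling permutes the residues modulo an odd prime.\<close>

lemma power_sum_eq_doubled:
  assumes "p > 2"
  shows "power_sum p n = (\<Sum>k<p. of_nat ((2 * k) mod p) ^ n)"
proof -
  have "bij_betw (\<lambda>k. (2 * k) mod p) {..<p} {..<p}"
  proof (rule bij_betwI')
    fix x y assume xy: "x \<in> {..<p}" "y \<in> {..<p}"
    have "coprime 2 p" using assms p_prime by (metis prime_odd_nat coprime_left_2_iff_odd)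
    then have "[2 * x = 2 * y] (mod p) \<longleftrightarrow> [x = y] (mod p)"
      by (rule cong_mult_lcancel_nat)
    then show "((2 * x) mod p = (2 * y) mod p) = (x = y)"
      using xy by (simp add: cong_def)
  next
    fix y assume y: "y \<in> {..<p}"
    have o: "odd p" using assms p_prime prime_odd_nat by blast
    show "\<exists>x\<in>{..<p}. y = (2 * x) mod p"
    proof (cases "even y")
      case True
      then show ?thesis using y by (intro bexI[of _ "y div 2"]) auto
    next
      case False
      then have "2 * ((y + p) div 2) = y + p" using o by auto
      then show ?thesis using y by (intro bexI[of _ "(y + p) div 2"]) auto
    qed
  qed (use assms in auto)
  then show ?thesis unfolding power_sum_def by (rule sum.reindex_bij_betw[symmetric])
qed

text \<open>Summed over \<open>k\<close>, these are the first two correction terms when \<open>(2k mod p)^(m+2)\<close> is expanded around \<open>(2k)^(m+2)\<close>, divided by \<open>m+2\<close>.\<close>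

definition voronoi_term :: "nat \<Rightarrow> nat \<Rightarrow> rat" where
  "voronoi_term m k = of_nat (m + 1) / 2 * of_nat p ^ 2 * of_nat ((2 * k) div p) ^ 2 * of_nat (2 * k) ^ m
      - of_nat p * of_nat ((2 * k) div p) * of_nat (2 * k) ^ (m + 1)"

text \<open>Expand the powers of 2k mod p = 2k - p (2k div p) to second order in p. Their sum is the
  power sum itself, while the leading terms sum to 2^(m+2) times it.\<close>

lemma voronoi_congruence:
  assumes "p > 2"
  shows "(1 - 2 ^ (m + 2)) * power_sum p (m + 2) - of_nat (m + 2) * (\<Sum>k<p. voronoi_term m k) \<in> I 3"
proof -
  have e: "(1 - 2 ^ (m + 2)) * power_sum p (m + 2) = power_sum p (m + 2) - (\<Sum>k<p. of_nat (2 * k) ^ (m + 2))"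
    by (simp only: power_sum_def left_diff_distrib sum_distrib_left power_mult_distrib of_nat_mult
      of_nat_numeral mult_1 sum_subtractf)
  have "(1 - 2 ^ (m + 2)) * power_sum p (m + 2) - of_nat (m + 2) * (\<Sum>k<p. voronoi_term m k) =
     (\<Sum>k<p. of_nat ((2 * k) mod p) ^ (m + 2) - of_nat (2 * k) ^ (m + 2) - of_nat (m + 2) * voronoi_term m k)"
    unfolding e by (subst power_sum_eq_doubled[OF assms]) (simp only: sum_subtractf sum_distrib_left)
  also have "\<dots> \<in> I 3"
  proof (rule p_ideal_sum)
    fix k
    define x q :: rat where "x = of_nat (2 * k)" and "q = of_nat ((2 * k) div p)"
    have e': "of_nat (2 * k) = (of_nat ((2 * k) div p * p + (2 * k) mod p) :: rat)"
      by (simp only: div_mult_mod_eq)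
    have r: "of_nat ((2 * k) mod p) = x - of_nat p * q"
      unfolding x_def q_def e' of_nat_add of_nat_mult[of "_ div _"] by simp
    have "(x - of_nat p * q) ^ (m + 2) - x ^ (m + 2) - of_nat (m + 2) * voronoi_term m k =
       (x - of_nat p * q) ^ (m + 2) - (x ^ (m + 2) - of_nat (m + 2) * (of_nat p * q * x ^ (m + 1))
     + of_nat (m + 2) * (of_nat (m + 1) / 2 * of_nat p ^ 2 * q ^ 2 * x ^ m))"
      unfolding voronoi_term_def x_def[symmetric] q_def[symmetric] by (simp only: algebra_simps)
    also have "\<dots> \<in> I 3"
      using assms by (intro power_expansion_p3) (auto simp: x_def q_def intro: of_nat_p_ideal simp del: of_nat_mult)
    finally show "of_nat ((2 * k) mod p) ^ (m + 2) - of_nat (2 * k) ^ (m + 2) - of_nat (m + 2) * voronoi_term m k \<in> I 3"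
      unfolding r x_def[symmetric] .
  qed
  finally show ?thesis .
qed

lemma p_ideal_mult_1_1: "x \<in> I 1 \<Longrightarrow> y \<in> I 1 \<Longrightarrow> x * y \<in> I 2"
  using p_ideal_mult[of x 1 y 1] by (simp only: one_add_one)

lemma p_ideal_mult_1_2: "x \<in> I 1 \<Longrightarrow> y \<in> I 2 \<Longrightarrow> x * y \<in> I 3"
  using p_ideal_mult[of x 1 y 2] by (simp add: numeral_3_eq_3)

lemma fermat_p_ideal:
  assumes "\<not> p dvd k"
  shows "of_nat k ^ (p - 1) - 1 \<in> I 1"
proof -
  have "[k ^ (p - 1) = 1] (mod p)" using fermat_theorem[OF p_prime assms] .
  then have "int p dvd int (k ^ (p - 1)) - 1"
    by (metis cong_iff_dvd_diff cong_int_iff of_nat_1)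
  then have "of_int (int (k ^ (p - 1)) - 1) \<in> I 1"
    by (simp only: of_int_p_ideal_1_iff)
  then show ?thesis by simp
qed

lemma p_ideal_half: "p > 2 \<Longrightarrow> x \<in> I n \<Longrightarrow> x / 2 \<in> I n"
  using divide_of_nat_p_ideal[of 2 x n] dvd_imp_le[of p 2] by auto

lemma voronoi_term_p_ideal:
  assumes "p > 2" shows "voronoi_term m k \<in> I 1"
proof -
  have "of_nat (m + 1) / 2 * of_nat p * of_nat ((2 * k) div p) ^ 2 * of_nat (2 * k) ^ m
      - of_nat ((2 * k) div p) * of_nat (2 * k) ^ (m + 1) \<in> I 0" (is "?x \<in> _")
    using assms by (intro p_ideal_half p_ideal_mult_left p_ideal_diff p_ideal_power of_nat_p_ideal)
  from p_ideal_mult_right[OF p_p_ideal this] show ?thesis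
    by (simp add: voronoi_term_def algebra_simps power2_eq_square)
qed

text \<open>Voronoi's congruence read modulo p: every correction term is divisible by p, and 1 - 2^n
  is a unit.\<close>

lemma power_sum_p_ideal_1:
  assumes "p > 2" "n \<ge> 2" "\<not> int p dvd 1 - 2 ^ n"
  shows "power_sum p n \<in> I 1"
proof -
  obtain m where n: "n = m + 2" using assms(2) le_Suc_ex by (metis add.commute)
  have "(1 - 2 ^ n) * power_sum p n = ((1 - 2 ^ n) * power_sum p n - of_nat n * (\<Sum>k<p. voronoi_term m k))
      + of_nat n * (\<Sum>k<p. voronoi_term m k)" by simp
  also have "\<dots> \<in> I 1"
    using voronoi_congruence[OF assms(1), of m] unfolding n
    by (intro p_ideal_add p_ideal_mult_left p_ideal_sum voronoi_term_p_ideal assms of_nat_p_ideal)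
       (erule p_ideal_antimono, simp)
  finally have "of_int (1 - 2 ^ n) * power_sum p n \<in> I 1" by simp
  then show ?thesis using assms(3) by (rule p_ideal_cancel_unit)
qed

text \<open>Kummer's congruences of the first two orders, with the Bernoulli numbers replaced by power sums.\<close>

lemma kummer_power_sums:
  assumes p2: "p > 2" and n2: "n \<ge> 2" and u: "\<not> int p dvd 1 - 2 ^ n"
    and dvd: "\<not> p dvd n" "\<not> p dvd n + (p - 1)" "\<not> p dvd n + 2 * (p - 1)"
  defines "X \<equiv> \<lambda>j. power_sum p (n + j * (p - 1)) / of_nat (n + j * (p - 1))"
  shows "X 0 \<in> I 1" "X 0 - X 1 \<in> I 2" "X 0 - 2 * X 1 + X 2 \<in> I 3"
proof -
  obtain m where n: "n = m + 2" using n2 le_Suc_ex by (metis add.commute)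
  \<comment> \<open>For the exponent n + j(p - 1), \<open>c j\<close> is the Voronoi multiplier and
    \<open>V j\<close> the Voronoi sum; \<open>M j\<close> is that exponent minus 2, the index used
    by \<open>voronoi_congruence\<close>.\<close>
  define c :: "nat \<Rightarrow> rat" where "c = (\<lambda>j. 1 - 2 ^ (n + j * (p - 1)))"
  define M where "M = (\<lambda>j. m + j * (p - 1))"
  define V where "V = (\<lambda>j. \<Sum>k<p. voronoi_term (M j) k)"
  define t :: rat where "t = 2 ^ (p - 1)"
  have t1: "t - 1 \<in> I 1"
    using fermat_p_ideal[of 2] p2 dvd_imp_le[of p 2] unfolding t_def by auto
  have c_t: "c j = 1 - 2 ^ n * t ^ j" for j
    unfolding c_def t_def power_mult[symmetric] by (simp add: power_add mult.commute)
  have t0: "2 ^ n \<in> I 0" "t \<in> I 0" unfolding t_def by (intro p_ideal_power numeral_p_ideal)+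
  \<comment> \<open>First differences of \<open>c\<close> contain t - 1, and the second difference
    contains its square.\<close>
  have c01: "c 0 - c 1 \<in> I 1"
    using p_ideal_mult_left[OF t0(1) t1] by (simp add: c_t algebra_simps)
  have c12: "c 1 - c 2 \<in> I 1"
    using p_ideal_mult_left[OF t0(2) p_ideal_mult_left[OF t0(1) t1]]
    by (simp add: c_t algebra_simps power2_eq_square)
  have c012: "c 0 - 2 * c 1 + c 2 \<in> I 2"
    using p_ideal_uminus[OF p_ideal_mult_left[OF t0(1) p_ideal_mult_1_1[OF t1 t1]]]
    by (simp add: c_t algebra_simps power2_eq_square)
  have V: "c j * X j - V j \<in> I 3" if "j \<le> 2" for j
  proof -
    have nj: "\<not> p dvd n + j * (p - 1)" using dvd that
      by (auto simp: le_Suc_eq numeral_2_eq_2)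
    then have nz: "of_nat (n + j * (p - 1)) \<noteq> (0 :: rat)"
      by (metis dvd_0_right of_nat_eq_0_iff)
    have e: "M j + 2 = n + j * (p - 1)" by (simp add: M_def n)
    have "((1 - 2 ^ (M j + 2)) * power_sum p (M j + 2) - of_nat (M j + 2) * V j) / of_nat (M j + 2) \<in> I 3"
      unfolding V_def using nj e by (intro divide_of_nat_p_ideal voronoi_congruence p2) simp
    moreover have "((1 - 2 ^ (M j + 2)) * power_sum p (M j + 2) - of_nat (M j + 2) * V j) / of_nat (M j + 2)
        = c j * X j - V j"
      unfolding e c_def X_def using nz by (simp only: diff_divide_distrib) simp
    ultimately show ?thesis by simp
  qed
  define x q z :: "nat \<Rightarrow> rat" where "x = (\<lambda>k. of_nat (2 * k))"
    and "q = (\<lambda>k. of_nat ((2 * k) div p))" and "z = (\<lambda>k. of_nat (2 * k) ^ (p - 1))"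
  have zp: "z k \<in> I 0" "x k \<in> I 0" "q k \<in> I 0" for k
    unfolding z_def x_def q_def by (intro p_ideal_power of_nat_p_ideal)+
  \<comment> \<open>Fermat makes 1 - z k divisible by p except at k = 0, where q k vanishes
    instead.\<close>
  have qz: "q k * (1 - z k) \<in> I 1" if k: "k < p" for k
  proof (cases "k = 0")
    case True
    then show ?thesis by (simp add: q_def p_ideal_0)
  next
    case False
    have "\<not> p dvd 2 * k"
      using p_prime p2 k False by (auto simp: prime_dvd_mult_iff dest: dvd_imp_le)
    then have "- (z k - 1) \<in> I 1" unfolding z_def
      by (intro p_ideal_uminus fermat_p_ideal)
    then show ?thesis using p_ideal_mult_left[OF zp(3)] by simp
  qed
  \<comment> \<open>The dependence on j is isolated: it is linear in one coefficient and otherwise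
    geometric through \<open>z k ^ j\<close>, so differences in j factor.\<close>
  have vt: "voronoi_term (M j) k = (of_nat m + 1 + of_nat j * (of_nat p - 1)) / 2 * of_nat p ^ 2 * q k ^ 2 * x k ^ m * z k ^ j
      - of_nat p * q k * x k ^ (m + 1) * z k ^ j" for j k
  proof -
    have e1: "of_nat (m + j * (p - 1) + 1) = (of_nat m + 1 + of_nat j * (of_nat p - 1) :: rat)"
      using prime_gt_0_nat[OF p_prime] by (simp add: of_nat_diff)
    have e2: "y ^ (m + j * (p - 1)) = y ^ m * (y ^ (p - 1)) ^ j" for y :: rat
      by (simp add: power_add mult.commute flip: power_mult)
    have e3: "y ^ (m + j * (p - 1) + 1) = y ^ (m + 1) * (y ^ (p - 1)) ^ j" for y :: rat
      using e2[of y] by simp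
    show ?thesis
      unfolding voronoi_term_def M_def x_def q_def z_def e1 e2 e3 by (simp only: mult.assoc)
  qed
  have V01: "V 0 - V 1 \<in> I 2"
    unfolding V_def sum_subtractf[symmetric]
  proof (rule p_ideal_sum)
    fix k assume k: "k \<in> {..<p}"
    have 1: "of_nat p * (x k ^ (m + 1) * (q k * (1 - z k))) \<in> I 2"
      using p_ideal_mult_1_1[OF p_p_ideal p_ideal_mult_left[OF p_ideal_power[OF zp(2)] qz[of k]]] k
      by blast
    have 2: "of_nat p ^ 2 * (((of_nat m + 1) - (of_nat m + of_nat p) * z k) / 2 * q k ^ 2 * x k ^ m) \<in> I 2"
      by (intro p_ideal_mult_right p_power_p_ideal p_ideal_half p2 p_ideal_mult_left p_ideal_diff
          p_ideal_add p_ideal_power zp of_nat_p_ideal one_p_ideal)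
    have "voronoi_term (M 0) k - voronoi_term (M 1) k =
       of_nat p ^ 2 * (((of_nat m + 1) - (of_nat m + of_nat p) * z k) / 2 * q k ^ 2 * x k ^ m)
       - of_nat p * (x k ^ (m + 1) * (q k * (1 - z k)))"
      unfolding vt by (simp add: field_simps)
    then show "voronoi_term (M 0) k - voronoi_term (M 1) k \<in> I 2"
      using p_ideal_diff[OF 2 1] by simp
  qed
  have V012: "V 0 - 2 * V 1 + V 2 \<in> I 3"
    unfolding V_def sum_subtractf[symmetric] sum_distrib_left sum.distrib[symmetric]
  proof (rule p_ideal_sum)
    fix k assume "k \<in> {..<p}"
    then have k: "k < p" by simp
    let ?y = "q k * (1 - z k)"
    have 1: "of_nat p * (x k ^ (m + 1) * (?y * ((1 - z k)))) \<in> I 3"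
    proof (cases "k = 0")
      case True
      then show ?thesis by (simp add: q_def p_ideal_0)
    next
      case False
      have "\<not> p dvd 2 * k"
        using p_prime p2 k False by (auto simp: prime_dvd_mult_iff dest: dvd_imp_le)
      then have "- (z k - 1) \<in> I 1" unfolding z_def
        by (intro p_ideal_uminus fermat_p_ideal)
      then have "?y * (1 - z k) \<in> I 2"
        using p_ideal_mult_1_1[OF qz[OF k], of "1 - z k"] by simp
      then show ?thesis
        using p_ideal_mult_1_2[OF p_p_ideal p_ideal_mult_left[OF p_ideal_power[OF zp(2)]]] by blast
    qed
    \<comment> \<open>The second difference of (A + jB) z^j is (1 - z)(A(1 - z) - 2Bz), here with B
      = p - 1; the factor 1 - z supplies the third p.\<close>
    have "((of_nat m + 1) * (1 - z k) - 2 * (of_nat p - 1) * z k) / 2 * (x k ^ m * q k) \<in> I 0"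
      by (intro p_ideal_half p2 p_ideal_mult_left p_ideal_diff
          p_ideal_add p_ideal_power zp of_nat_p_ideal one_p_ideal numeral_p_ideal)
    from p_power_mult_p_ideal[OF p_ideal_mult_left[OF this qz[OF k]], of 2]
    have 2: "of_nat p ^ 2 * (((of_nat m + 1) * (1 - z k) - 2 * (of_nat p - 1) * z k) / 2 * (x k ^ m * q k) * ?y) \<in> I 3"
      by simp
    have "voronoi_term (M 0) k - 2 * voronoi_term (M 1) k + voronoi_term (M 2) k =
      of_nat p ^ 2 * (((of_nat m + 1) * (1 - z k) - 2 * (of_nat p - 1) * z k) / 2 * (x k ^ m * q k) * ?y)
      - of_nat p * (x k ^ (m + 1) * (?y * (1 - z k)))"
      unfolding vt by (simp add: field_simps power2_eq_square)
    then show "voronoi_term (M 0) k - 2 * voronoi_term (M 1) k + voronoi_term (M 2) k \<in> I 3"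
      using p_ideal_diff[OF 2 1] by simp
  qed
  \<comment> \<open>By Fermat \<open>c j\<close> is congruent to 1 - 2^n modulo p, hence a unit by
    assumption \<open>u\<close>.\<close>
  have cancel: "y \<in> I i" if "c j * y \<in> I i" for y i j
  proof -
    have "\<not> p dvd 2" using p2 by (auto dest: dvd_imp_le)
    then have "[2 ^ (p - 1) = 1] (mod p)" using fermat_theorem[OF p_prime] by blast
    then have "[int 2 ^ (p - 1) = 1] (mod int p)"
      by (metis cong_int_iff of_nat_1 of_nat_power)
    then have "[1 - 2 ^ n * (2 ^ (p - 1)) ^ j = 1 - 2 ^ n * 1 ^ j] (mod int p)"
      by (intro cong_diff cong_mult cong_pow) auto
    then have "\<not> int p dvd 1 - 2 ^ n * (2 ^ (p - 1)) ^ j"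
      using u by (simp add: cong_dvd_iff)
    moreover have "of_int (1 - 2 ^ n * (2 ^ (p - 1)) ^ j) * y \<in> I i"
      using that by (simp add: c_t t_def)
    ultimately show ?thesis using p_ideal_cancel_unit by blast
  qed
  show X0: "X 0 \<in> I 1"
    using power_sum_p_ideal_1[OF p2 n2 u] dvd(1) by (simp add: X_def divide_of_nat_p_ideal)
  have "c 1 * (X 0 - X 1) = (c 0 * X 0 - V 0) - (c 1 * X 1 - V 1) + (V 0 - V 1) - (c 0 - c 1) * X 0"
    by (simp add: algebra_simps)
  also have "\<dots> \<in> I 2"
    using V[THEN p_ideal_antimono, of 0 2] V[THEN p_ideal_antimono, of 1 2]
    by (intro p_ideal_diff[OF _ p_ideal_mult_1_1[OF c01 X0]] p_ideal_add[OF _ V01] p_ideal_diff[of "_ - _" _ "_ - _"]) simp_all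
  finally show X01: "X 0 - X 1 \<in> I 2" by (rule cancel)
  \<comment> \<open>Discrete Leibniz rule for the products \<open>c j * X j\<close>, solved for the
    second difference of \<open>X\<close>; in each correction the orders of the two factors add up
    to 3.\<close>
  have "c 2 * (X 0 - 2 * X 1 + X 2) = (c 0 * X 0 - V 0) - 2 * (c 1 * X 1 - V 1) + (c 2 * X 2 - V 2)
      + (V 0 - 2 * V 1 + V 2) - (c 0 - 2 * c 1 + c 2) * X 0 - 2 * ((c 1 - c 2) * (X 0 - X 1))"
    by (simp add: algebra_simps)
  also have "\<dots> \<in> I 3"
  proof (rule p_ideal_diff[OF p_ideal_diff[OF p_ideal_add[OF p_ideal_add[OF p_ideal_diff[OF V
            p_ideal_mult_left[OF numeral_p_ideal V]] V] V012]] p_ideal_mult_left[OF numeral_p_ideal]])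
    show "(c 0 - 2 * c 1 + c 2) * X 0 \<in> I 3"
      using p_ideal_mult_1_2[OF X0 c012] by (simp only: mult.commute)
    show "(c 1 - c 2) * (X 0 - X 1) \<in> I 3" using p_ideal_mult_1_2[OF c12 X01] .
  qed auto
  finally show "X 0 - 2 * X 1 + X 2 \<in> I 3" by (rule cancel)
qed

end

text \<open>By Fermat 2^(n+r) = 1 modulo p, so 2^r (1 - 2^n) is congruent to 2^r - 1; only a fixed
  small r has to be checked.\<close>

lemma (in p_adic) not_dvd_one_minus_two_power:
  assumes "p > 2" "p - 1 dvd n + r" "\<not> int p dvd 2 ^ r - 1"
  shows "\<not> int p dvd 1 - 2 ^ n"
proof
  assume "int p dvd 1 - 2 ^ n"
  then have "int p dvd 2 ^ r * (1 - 2 ^ n)" by simp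
  moreover have "int p dvd 2 ^ (n + r) - 1"
  proof -
    obtain j where j: "n + r = (p - 1) * j" using assms(2) by blast
    have "\<not> p dvd 2" using assms(1) dvd_imp_le[of p 2] by auto
    then have "[2 ^ (p - 1) = 1] (mod p)" using fermat_theorem[OF p_prime] by blast
    then have "[(2 ^ (p - 1)) ^ j = 1 ^ j] (mod p)" by (rule cong_pow)
    then have "[2 ^ (n + r) = 1] (mod p)" unfolding j power_mult by simp
    then have "[int (2 ^ (n + r)) = int 1] (mod int p)" by (simp only: cong_int_iff)
    then show ?thesis by (simp add: cong_iff_dvd_diff)
  qed
  ultimately have "int p dvd 2 ^ r * (1 - 2 ^ n) + (2 ^ (n + r) - 1)" by (rule dvd_add)
  also have "2 ^ r * (1 - 2 ^ n) + (2 ^ (n + r) - 1) = 2 ^ r - (1 :: int)"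
    by (simp add: power_add algebra_simps)
  finally show False using assms(3) by blast
qed

section \<open>The sum of inverse squares in terms of Bernoulli numbers\<close>

locale p_adic_ge7 = p_adic +
  assumes p_ge7: "p \<ge> 7"
begin

lemma p_gt2: "p > 2" using p_ge7 by simp

lemma not_p_dvd_less: "0 < k \<Longrightarrow> k < p \<Longrightarrow> \<not> p dvd k"
  using dvd_imp_le by fastforce

lemma not_dvd_one_minus_two_power_minus2: "p - 1 dvd n + 2 \<Longrightarrow> \<not> int p dvd 1 - 2 ^ n"
  using p_ge7 by (intro not_dvd_one_minus_two_power[OF p_gt2, of n 2]) (auto dest: zdvd_imp_le)

lemma not_dvd_one_minus_two_power_minus4: "p - 1 dvd n + 4 \<Longrightarrow> \<not> int p dvd 1 - 2 ^ n"
proof (rule not_dvd_one_minus_two_power[OF p_gt2])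
  \<comment> \<open>2^4 - 1 = 15, and both of its prime factors lie below p.\<close>
  have "\<not> p dvd 3 * 5"
    using p_prime p_ge7 by (subst prime_dvd_mult_iff) (auto dest: dvd_imp_le)
  then have "\<not> int p dvd int (3 * 5)" by (simp only: int_dvd_int_iff) simp
  then show "\<not> int p dvd 2 ^ 4 - 1" by simp
qed

lemma p_ideal_third: "x \<in> I n \<Longrightarrow> x / 3 \<in> I n"
  using divide_of_nat_p_ideal[of 3 x n] not_p_dvd_less[of 3] p_ge7 by simp

lemma p_ideal_half': "x \<in> I n \<Longrightarrow> x / 2 \<in> I n"
  by (rule p_ideal_half[OF p_gt2])

lemma inverse_power_p_ideal: "0 < k \<Longrightarrow> k < p \<Longrightarrow> 1 / of_nat k ^ r \<in> I 0"
  using p_ideal_power[OF inverse_of_nat_p_ideal[of k], of r] not_p_dvd_less[of k]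
  by (simp add: power_one_over)

lemma power_sum_eq: "n > 0 \<Longrightarrow> power_sum p n = (\<Sum>k=1..p-1. of_nat k ^ n)"
proof -
  assume "n > 0"
  have "{..<p} = insert 0 {1..p-1}" using p_ge7 by auto
  with \<open>n > 0\<close> show ?thesis by (simp add: power_sum_def)
qed

text \<open>The exponents are -2 + j(p - 1) for j = 1, 2, 3, so with z = k^(p-1) each term of the
  difference equals -(z - 1)^3 / k^2.\<close>

lemma harm_sum_2_power_sums:
  "harm_sum 2 (p - 1) - (power_sum p (3 * p - 5) - 3 * power_sum p (2 * p - 4) + 3 * power_sum p (p - 3)) \<in> I 3"
proof -
  have "harm_sum 2 (p - 1) - (power_sum p (3 * p - 5) - 3 * power_sum p (2 * p - 4) + 3 * power_sum p (p - 3))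
     = (\<Sum>k=1..p-1. 1 / of_nat k ^ 2 - (of_nat k ^ (3 * p - 5) - 3 * of_nat k ^ (2 * p - 4) + 3 * of_nat k ^ (p - 3)))"
    using p_ge7 by (subst power_sum_eq, simp)+
      (simp only: harm_sum_def sum_subtractf sum.distrib sum_distrib_left)
  also have "\<dots> \<in> I 3"
  proof (rule p_ideal_sum)
    fix k assume "k \<in> {1..p-1}"
    then have k: "0 < k" "k < p" by auto
    define x z :: rat where "x = of_nat k" and "z = of_nat k ^ (p - 1)"
    have x0: "x \<noteq> 0" using k by (simp add: x_def)
    have z: "z - 1 \<in> I 1"
      unfolding z_def by (intro fermat_p_ideal not_p_dvd_less k)
    have "p - 3 + 2 = p - 1" "2 * p - 4 + 2 = (p - 1) * 2" "3 * p - 5 + 2 = (p - 1) * 3"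
      using p_ge7 by auto
    then have e: "x ^ (p - 3) * x ^ 2 = z" "x ^ (2 * p - 4) * x ^ 2 = z ^ 2" "x ^ (3 * p - 5) * x ^ 2 = z ^ 3"
      unfolding z_def x_def power_add[symmetric] power_mult[symmetric] by (simp_all only:)
    have e': "x ^ (p - 3) = z / x ^ 2" "x ^ (2 * p - 4) = z ^ 2 / x ^ 2" "x ^ (3 * p - 5) = z ^ 3 / x ^ 2"
      using e x0 by (simp_all add: field_simps)
    have "1 / x ^ 2 - (x ^ (3 * p - 5) - 3 * x ^ (2 * p - 4) + 3 * x ^ (p - 3))
        = - (1 / x ^ 2 * ((z - 1) * ((z - 1) * (z - 1))))"
      unfolding e' using x0 by (simp add: field_simps power2_eq_square power3_eq_cube)
    also have "\<dots> \<in> I 3"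
      unfolding x_def
      by (intro p_ideal_uminus p_ideal_mult_left inverse_power_p_ideal k
          p_ideal_mult_1_2 p_ideal_mult_1_1 z)
    finally show "1 / of_nat k ^ 2 - (of_nat k ^ (3 * p - 5) - 3 * of_nat k ^ (2 * p - 4) + 3 * of_nat k ^ (p - 3)) \<in> I 3"
      by (simp only: x_def)
  qed
  finally show ?thesis .
qed

text \<open>The exponent is -4 modulo p - 1. This and the exponent 2p - 6 supply the n - 2
  hypothesis of \<open>power_sum_cong_bernoulli_mod_p3\<close>.\<close>

lemma power_sum_p_minus_5: "power_sum p (p - 5) \<in> I 1"
  using p_ge7 by (intro power_sum_p_ideal_1 not_dvd_one_minus_two_power_minus4) auto

lemma not_dvd_one_minus_two_power_p_minus_3: "\<not> int p dvd 1 - 2 ^ (p - 3)"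
proof -
  have "p - 3 + 2 = p - 1" using p_ge7 by simp
  then show ?thesis by (intro not_dvd_one_minus_two_power_minus2) simp
qed

lemma power_sum_p_minus_3: "power_sum p (p - 3) \<in> I 1"
  using p_ge7 by (intro power_sum_p_ideal_1 not_dvd_one_minus_two_power_p_minus_3) auto

lemma power_sum_2p_minus_6: "power_sum p (2 * p - 6) \<in> I 1"
proof -
  have "2 * p - 6 + 4 = (p - 1) * 2" using p_ge7 by auto
  then show ?thesis using p_ge7
    by (intro power_sum_p_ideal_1 not_dvd_one_minus_two_power_minus4) auto
qed

lemma odd_p: "odd p" using p_prime p_gt2 prime_odd_nat by blast

lemma harm_sum_2_cong_power_sums:
  "harm_sum 2 (p - 1) - (4 / 3 * power_sum p (p - 3) - power_sum p (2 * p - 4) / 2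
     + of_nat p / 9 * power_sum p (p - 3)) \<in> I 3"
proof -
  define X where "X = (\<lambda>j. power_sum p (p - 3 + j * (p - 1)) / of_nat (p - 3 + j * (p - 1)))"
  have n: "p - 3 + 1 * (p - 1) = 2 * p - 4" "p - 3 + 2 * (p - 1) = 3 * p - 5" using p_ge7 by auto
  have "\<not> p dvd p - 3" using p_ge7 by (intro not_p_dvd_less) auto
  moreover have "\<not> p dvd p - 3 + (p - 1)"
  proof
    assume "p dvd p - 3 + (p - 1)"
    then have "p dvd 2 * p - (p - 3 + (p - 1))" by (intro dvd_diff_nat) auto
    moreover have "2 * p - (p - 3 + (p - 1)) = 4" using p_ge7 by auto
    ultimately show False using not_p_dvd_less[of 4] p_ge7 by simp
  qed
  moreover have "\<not> p dvd p - 3 + 2 * (p - 1)"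
  proof
    assume "p dvd p - 3 + 2 * (p - 1)"
    then have "p dvd 3 * p - (p - 3 + 2 * (p - 1))" by (intro dvd_diff_nat) auto
    moreover have "3 * p - (p - 3 + 2 * (p - 1)) = 5" using p_ge7 by auto
    ultimately show False using not_p_dvd_less[of 5] p_ge7 by simp
  qed
  moreover note not_dvd_one_minus_two_power_p_minus_3
  ultimately have K: "X 0 \<in> I 1" "X 0 - X 1 \<in> I 2" "X 0 - 2 * X 1 + X 2 \<in> I 3"
    unfolding X_def using p_ge7 by (intro kummer_power_sums; simp)+
  define q :: rat where "q = of_nat p"
  have c: "of_nat (p - 3) = q - 3" "of_nat (2 * p - 4) = 2 * q - 4" "of_nat (3 * p - 5) = 3 * q - 5"
    using p_ge7 by (auto simp: q_def of_nat_diff)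
  have nz: "q - 3 \<noteq> 0" "2 * q - 4 \<noteq> 0" "3 * q - 5 \<noteq> 0"
    using p_ge7 unfolding c[symmetric] by auto
  have P: "power_sum p (p - 3) = (q - 3) * X 0" "power_sum p (2 * p - 4) = (2 * q - 4) * X 1"
      "power_sum p (3 * p - 5) = (3 * q - 5) * X 2"
    unfolding X_def n using nz by (simp_all add: c del: of_nat_mult)
  \<comment> \<open>With each power sum written as its exponent times \<open>X\<close>, the
    coefficients 4/3, 1/2 and 1/9 leave, besides the second difference, only q (X 0 - X 1) and q^2 X
    0 / 9, both of order p^3.\<close>
  have "harm_sum 2 (p - 1) - (4 / 3 * power_sum p (p - 3) - power_sum p (2 * p - 4) / 2
     + of_nat p / 9 * power_sum p (p - 3)) =
     (harm_sum 2 (p - 1) - (power_sum p (3 * p - 5) - 3 * power_sum p (2 * p - 4) + 3 * power_sum p (p - 3)))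
     + (3 * q - 5) * (X 0 - 2 * X 1 + X 2) - q * (X 0 - X 1) - q ^ 2 * X 0 / 3 / 3"
    unfolding P q_def[symmetric] by (simp add: field_simps power2_eq_square)
  also have "\<dots> \<in> I 3"
  proof (intro p_ideal_diff[of "_ - _ * _"] p_ideal_diff[of "_ + _" _ "_ * _"]
      p_ideal_add[OF harm_sum_2_power_sums] p_ideal_third)
    show "(3 * q - 5) * (X 0 - 2 * X 1 + X 2) \<in> I 3"
      unfolding c[symmetric] by (intro p_ideal_mult_left K of_nat_p_ideal)
    show "q * (X 0 - X 1) \<in> I 3"
      unfolding q_def by (intro p_ideal_mult_1_2 K p_p_ideal)
    show "q ^ 2 * X 0 \<in> I 3"
      using p_power_mult_p_ideal[OF K(1), of 2] unfolding q_def by simp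
  qed
  finally show ?thesis .
qed

lemma harm_sum_2_cong_bernoulli:
  "harm_sum 2 (p - 1) - (of_nat p * (4 / 3 * bernoulli (p - 3) - bernoulli (2 * p - 4) / 2)
     + of_nat p ^ 2 * bernoulli (p - 3) / 9) \<in> I 3"
proof -
  have 2: "p - 3 - 2 = p - 5" "2 * p - 4 - 2 = 2 * p - 6" by auto
  have D0: "power_sum p (p - 3) - of_nat p * bernoulli (p - 3) \<in> I 3" (is "?D0 \<in> _")
    using p_ge7 odd_p power_sum_p_minus_5 by (intro power_sum_cong_bernoulli_mod_p3) (auto simp: 2)
  have D1: "power_sum p (2 * p - 4) - of_nat p * bernoulli (2 * p - 4) \<in> I 3" (is "?D1 \<in> _")
    using p_ge7 power_sum_2p_minus_6 by (intro power_sum_cong_bernoulli_mod_p3) (auto simp: 2)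
  have "harm_sum 2 (p - 1) - (of_nat p * (4 / 3 * bernoulli (p - 3) - bernoulli (2 * p - 4) / 2)
     + of_nat p ^ 2 * bernoulli (p - 3) / 9) =
     (harm_sum 2 (p - 1) - (4 / 3 * power_sum p (p - 3) - power_sum p (2 * p - 4) / 2
     + of_nat p / 9 * power_sum p (p - 3))) + 4 * ?D0 / 3 - ?D1 / 2 + of_nat p * ?D0 / 3 / 3"
    by (simp add: field_simps power2_eq_square)
  also have "\<dots> \<in> I 3"
    by (intro p_ideal_add[OF p_ideal_diff[OF p_ideal_add[OF harm_sum_2_cong_power_sums]]]
        p_ideal_half' p_ideal_third p_ideal_mult_left[OF numeral_p_ideal] p_ideal_mult_left[OF of_nat_p_ideal] D0 D1)
  finally show ?thesis .
qed

end

subsection \<open>Harmonic sums modulo powers of p\<close>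

text \<open>Again the complete homogeneous sum of degree 2, now in the squares 1/k^2.\<close>

lemma sum_harm_sum_2_divide:
  "(\<Sum>k=1..n. harm_sum 2 k / of_nat k ^ 2) = (harm_sum 2 n ^ 2 + harm_sum 4 n) / 2"
proof (induction n)
  case (Suc n)
  define y :: rat where "y = 1 / of_nat (Suc n) ^ 2"
  have "(of_nat (Suc n) :: rat) ^ 4 = of_nat (Suc n) ^ 2 * of_nat (Suc n) ^ 2"
    by (simp only: power_add[symmetric]) simp
  then have y4: "1 / of_nat (Suc n) ^ 4 = y * y" by (simp add: y_def)
  have y: "a / of_nat (Suc n) ^ 2 = a * y" for a by (simp add: y_def)
  show ?case
    unfolding sum.cl_ivl_Suc harm_sum_Suc y y4 using Suc
    by (simp add: power2_eq_square algebra_simps add_divide_distrib del: of_nat_Suc)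
qed simp

text \<open>The two sums cover the index pairs of H_1 H_3 on either side of the diagonal; the
  diagonal is counted twice, which adds H_4.\<close>

lemma sum_harm_sum_1_3:
  "(\<Sum>k=1..n. harm_sum 1 k / of_nat k ^ 3) + (\<Sum>k=1..n. harm_sum 3 k / of_nat k)
     = harm_sum 1 n * harm_sum 3 n + harm_sum 4 n"
proof (induction n)
  case (Suc n)
  define y :: rat where "y = 1 / of_nat (Suc n)"
  have y: "a / of_nat (Suc n) ^ k = a * y ^ k" "a / of_nat (Suc n) = a * y" for a k
    by (simp_all add: y_def power_divide del: of_nat_Suc)
  have y4: "y ^ 4 = y * y ^ 3" by (simp add: power_numeral_reduce)
  show ?case
    unfolding sum.cl_ivl_Suc harm_sum_Suc y using Suc
    by (simp add: algebra_simps y4 del: of_nat_Suc)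
qed simp

context p_adic_ge7
begin

lemma harm_sum_p_ideal: "k < p \<Longrightarrow> harm_sum r k \<in> I 0"
  unfolding harm_sum_def by (intro p_ideal_sum inverse_power_p_ideal) auto

lemma p_ideal_power_diff:
  assumes "x \<in> I 0" "y \<in> I 0" "x - y \<in> I 1"
  shows "x ^ r - y ^ r \<in> I 1"
proof (induction r)
  case (Suc r)
  have "x ^ Suc r - y ^ Suc r = x * (x ^ r - y ^ r) + y ^ r * (x - y)"
    by (simp add: algebra_simps)
  also have "\<dots> \<in> I 1"
    by (intro p_ideal_add p_ideal_mult_left p_ideal_power assms Suc)
  finally show ?case .
qed (simp add: p_ideal_0)

text \<open>The remainder is kept exact, with p explicit, so that the odd harmonic sums can gain a
  second factor p from it.\<close>

lemma inverse_reflect: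
  assumes "0 < k" "k < p"
  shows "1 / of_nat (p - k) + 1 / of_nat k = (of_nat p * (1 / of_nat (p - k) * (1 / of_nat k)) :: rat)"
proof -
  have "(of_nat (p - k) :: rat) \<noteq> 0" "(of_nat k :: rat) \<noteq> 0" using assms by auto
  moreover have "(of_nat p :: rat) = of_nat (p - k) + of_nat k" using assms by (simp add: of_nat_diff)
  moreover have "1 / a + 1 / b = (a + b) * (1 / a * (1 / b))" if "a \<noteq> 0" "b \<noteq> 0" for a b :: rat
    using that by (simp add: field_simps)
  ultimately show ?thesis by metis
qed

lemma inverse_p_ideal: "0 < k \<Longrightarrow> k < p \<Longrightarrow> 1 / of_nat k \<in> I 0"
  using inverse_power_p_ideal[of k 1] by simp

lemma inverse_reflect_p_ideal:
  assumes "0 < k" "k < p"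
  shows "1 / of_nat (p - k) - (- 1 / of_nat k) \<in> I 1"
proof -
  have "of_nat p * (1 / of_nat (p - k) * (1 / of_nat k)) \<in> I 1"
    using assms by (intro p_ideal_mult_right p_p_ideal p_ideal_mult_left inverse_p_ideal) auto
  then show ?thesis using inverse_reflect[OF assms] by simp
qed

lemma inverse_power_reflect_p_ideal:
  assumes "0 < k" "k < p"
  shows "1 / of_nat (p - k) ^ r - (- 1) ^ r / of_nat k ^ r \<in> I 1"
proof -
  have "1 / of_nat (p - k) \<in> I 0" "- 1 / of_nat k \<in> I 0"
    using inverse_p_ideal[of "p - k"] p_ideal_uminus[OF inverse_p_ideal[of k]] assms by simp_all
  from p_ideal_power_diff[OF this inverse_reflect_p_ideal[OF assms], of r] show ?thesis
    by (simp only: power_divide power_one)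
qed

lemma sum_reflect: "(\<Sum>k=1..p-1. f (p - k)) = (\<Sum>k=1..p-1. f k :: rat)"
proof -
  have "p - 1 + 1 = p" using p_ge7 by simp
  then show ?thesis using sum.atLeastAtMost_rev[of f 1 "p - 1"] by metis
qed

text \<open>Termwise Fermat: k^(-r) is congruent to k^(p-1-r).\<close>

lemma harm_sum_cong_power_sum:
  assumes "r < p - 1"
  shows "harm_sum r (p - 1) - power_sum p (p - 1 - r) \<in> I 1"
proof -
  have "harm_sum r (p - 1) - power_sum p (p - 1 - r) = (\<Sum>k=1..p-1. 1 / of_nat k ^ r - of_nat k ^ (p - 1 - r))"
    using assms by (subst power_sum_eq) (auto simp: harm_sum_def sum_subtractf)
  also have "\<dots> \<in> I 1"
  proof (rule p_ideal_sum)
    fix k assume "k \<in> {1..p-1}"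
    then have k: "0 < k" "k < p" by auto
    have "(of_nat k :: rat) ^ (p - 1) = of_nat k ^ (p - 1 - r) * of_nat k ^ r"
      using assms by (simp flip: power_add)
    then have "1 / of_nat k ^ r - of_nat k ^ (p - 1 - r) = (- (1 / of_nat k ^ r * (of_nat k ^ (p - 1) - 1)) :: rat)"
      using k by (simp add: field_simps)
    also have "\<dots> \<in> I 1"
      by (intro p_ideal_uminus p_ideal_mult_left inverse_power_p_ideal fermat_p_ideal not_p_dvd_less k)
    finally show "1 / of_nat k ^ r - of_nat k ^ (p - 1 - r) \<in> I 1" .
  qed
  finally show ?thesis .
qed

lemma harm_sum_2_p_ideal: "harm_sum 2 (p - 1) \<in> I 1"
  using p_ideal_add[OF harm_sum_cong_power_sum[of 2], of "power_sum p (p - 3)"] power_sum_p_minus_3 p_ge7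
  by (simp add: numeral_3_eq_3)

lemma harm_sum_4_p_ideal: "harm_sum 4 (p - 1) \<in> I 1"
  using p_ideal_add[OF harm_sum_cong_power_sum[of 4] power_sum_p_minus_5] p_ge7 by simp

lemma p_ideal_double_cancel: "x + x \<in> I n \<Longrightarrow> x \<in> I n"
  using p_ideal_half'[of "x + x" n] by simp

text \<open>Wolstenholme's theorem. Pairing k with p - k gives 2 H_1 as p times the sum of
  1/(k(p-k)), which is -H_2 and hence 0 modulo p.\<close>

lemma harm_sum_1_p_ideal: "harm_sum 1 (p - 1) \<in> I 2"
proof (rule p_ideal_double_cancel)
  let ?w = "\<lambda>k. 1 / of_nat (p - k) * (1 / of_nat k) :: rat"
  have "(\<Sum>k=1..p-1. ?w k) = (\<Sum>k=1..p-1. ?w k + 1 / of_nat k ^ 2) - harm_sum 2 (p - 1)"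
    by (simp add: sum.distrib harm_sum_def)
  also have "\<dots> \<in> I 1"
  proof (intro p_ideal_diff harm_sum_2_p_ideal p_ideal_sum)
    fix k assume "k \<in> {1..p-1}"
    then have k: "0 < k" "k < p" by auto
    have "?w k + 1 / of_nat k ^ 2 = 1 / of_nat k * (1 / of_nat (p - k) - (- 1 / of_nat k))"
      by (simp add: algebra_simps power2_eq_square)
    also have "\<dots> \<in> I 1"
      by (intro p_ideal_mult_left inverse_p_ideal inverse_reflect_p_ideal k)
    finally show "?w k + 1 / of_nat k ^ 2 \<in> I 1" .
  qed
  finally have "of_nat p * (\<Sum>k=1..p-1. ?w k) \<in> I 2"
    by (intro p_ideal_mult_1_1 p_p_ideal)
  moreover have "harm_sum 1 (p - 1) + harm_sum 1 (p - 1) = (\<Sum>k=1..p-1. 1 / of_nat (p - k) + 1 / of_nat k)"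
    using sum_reflect[of "\<lambda>k. 1 / of_nat k"] by (simp add: harm_sum_def sum.distrib)
  moreover have "\<dots> = (\<Sum>k=1..p-1. of_nat p * ?w k)"
    by (intro sum.cong refl inverse_reflect) auto
  ultimately show "harm_sum 1 (p - 1) + harm_sum 1 (p - 1) \<in> I 2"
    by (simp only: sum_distrib_left)
qed

text \<open>The same pairing, with u^3 + v^3 divided by u + v; the cofactor \<open>?w k\<close> is
  -3/k^4 modulo p, and H_4 vanishes modulo p.\<close>

lemma harm_sum_3_p_ideal: "harm_sum 3 (p - 1) \<in> I 2"
proof (rule p_ideal_double_cancel)
  let ?y = "\<lambda>k. 1 / of_nat (p - k) :: rat"
  let ?x = "\<lambda>k. 1 / of_nat k :: rat"
  let ?w = "\<lambda>k. ?y k * ?x k * (?y k ^ 2 - ?y k * ?x k + ?x k ^ 2)"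
  have "(\<Sum>k=1..p-1. ?w k) = (\<Sum>k=1..p-1. ?w k + 3 * (1 / of_nat k ^ 4)) - 3 * harm_sum 4 (p - 1)"
    by (simp add: sum.distrib harm_sum_def sum_distrib_left)
  also have "\<dots> \<in> I 1"
  proof (intro p_ideal_diff p_ideal_mult_left[OF numeral_p_ideal] harm_sum_4_p_ideal p_ideal_sum)
    fix k assume "k \<in> {1..p-1}"
    then have k: "0 < k" "k < p" by auto
    have y: "?y k \<in> I 0" and x: "?x k \<in> I 0" 
      using k by (intro inverse_p_ideal; simp)+
    have x4: "1 / of_nat k ^ 4 = ?x k ^ 4" by (simp add: power_one_over)
    have "u * v * (u ^ 2 - u * v + v ^ 2) + 3 * v ^ 4 =
        v * (u ^ 2 - 2 * (u * v) + 3 * v ^ 2) * (u - (- v))" for u v :: rat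
      by (simp add: algebra_simps power2_eq_square power4_eq_xxxx)
    from this[of "?y k" "?x k"] have "?w k + 3 * (1 / of_nat k ^ 4) =
        ?x k * (?y k ^ 2 - 2 * (?y k * ?x k) + 3 * ?x k ^ 2) * (?y k - (- 1 / of_nat k))"
      unfolding x4 by (simp only: minus_divide_left)
    also have "\<dots> \<in> I 1"
      by (intro p_ideal_mult_left[OF _ inverse_reflect_p_ideal[OF k]] p_ideal_mult_left p_ideal_add
          p_ideal_diff p_ideal_power numeral_p_ideal x y)
    finally show "?w k + 3 * (1 / of_nat k ^ 4) \<in> I 1" .
  qed
  finally have "of_nat p * (\<Sum>k=1..p-1. ?w k) \<in> I 2"
    by (intro p_ideal_mult_1_1 p_p_ideal)
  moreover have "harm_sum 3 (p - 1) + harm_sum 3 (p - 1) = (\<Sum>k=1..p-1. ?y k ^ 3 + ?x k ^ 3)"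
    using sum_reflect[of "\<lambda>k. 1 / of_nat k ^ 3"] by (simp add: harm_sum_def sum.distrib power_one_over)
  moreover have "\<dots> = (\<Sum>k=1..p-1. of_nat p * ?w k)"
  proof (intro sum.cong refl)
    fix k assume "k \<in> {1..p-1}"
    then have k: "0 < k" "k < p" by auto
    have "u ^ 3 + v ^ 3 = (u + v) * (u ^ 2 - u * v + v ^ 2)" for u v :: rat
      by (simp add: algebra_simps power2_eq_square power3_eq_cube)
    then have "?y k ^ 3 + ?x k ^ 3 = (?y k + ?x k) * (?y k ^ 2 - ?y k * ?x k + ?x k ^ 2)" .
    then show "?y k ^ 3 + ?x k ^ 3 = of_nat p * ?w k"
      unfolding inverse_reflect[OF k] by (simp only: mult.assoc)
  qed
  ultimately show "harm_sum 3 (p - 1) + harm_sum 3 (p - 1) \<in> I 2"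
    by (simp only: sum_distrib_left)
qed

text \<open>H_1(p-1) is 0 modulo p, and removing its last k terms 1/(p-j) amounts to adding
  H_1(k).\<close>

lemma harm_sum_1_reflect: "k < p \<Longrightarrow> harm_sum 1 (p - 1 - k) - harm_sum 1 k \<in> I 1"
proof (induction k)
  case 0
  then show ?case using p_ideal_antimono[OF harm_sum_1_p_ideal, of 1] by simp
next
  case (Suc k)
  have "p - 1 - k = Suc (p - 1 - Suc k)" using Suc.prems by simp
  then have "harm_sum 1 (p - 1 - k) = harm_sum 1 (p - 1 - Suc k) + 1 / of_nat (p - Suc k)"
    by (metis harm_sum_Suc power_one_right diff_Suc_eq_diff_pred)
  then have "harm_sum 1 (p - 1 - Suc k) - harm_sum 1 (Suc k) =
      (harm_sum 1 (p - 1 - k) - harm_sum 1 k) - (1 / of_nat (p - Suc k) - (- 1 / of_nat (Suc k)))"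
    by (simp add: harm_sum_Suc)
  also have "\<dots> \<in> I 1"
    using Suc by (intro p_ideal_diff[OF _ inverse_reflect_p_ideal]) auto
  finally show ?case .
qed

text \<open>Reflection turns H_1(k)/k^3 into -H_1(k-1)/k^3 modulo p, so twice the sum is congruent
  to H_4.\<close>

lemma sum_harm_sum_1_cube_p_ideal: "(\<Sum>k=1..p-1. harm_sum 1 k / of_nat k ^ 3) \<in> I 1" (is "?S \<in> _")
proof (rule p_ideal_double_cancel)
  have "?S = (\<Sum>k=1..p-1. harm_sum 1 (p - k) / of_nat (p - k) ^ 3)"
    by (rule sum_reflect[symmetric])
  then have "?S + ?S = (\<Sum>k=1..p-1. harm_sum 1 (p - k) / of_nat (p - k) ^ 3 + harm_sum 1 k / of_nat k ^ 3
      - 1 / of_nat k ^ 4) + harm_sum 4 (p - 1)"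
    by (simp add: sum.distrib sum_subtractf harm_sum_def)
  also have "\<dots> \<in> I 1"
  proof (intro p_ideal_add harm_sum_4_p_ideal p_ideal_sum)
    fix k assume "k \<in> {1..p-1}"
    then have k: "0 < k" "k < p" by auto
    then obtain m where m: "k = Suc m" using gr0_implies_Suc by blast
    have pm: "p - 1 - m = p - k" using m k by simp
    have h: "harm_sum 1 m = harm_sum 1 k - 1 / of_nat k" by (simp add: m harm_sum_Suc)
    have x4: "1 / of_nat k ^ 4 = 1 / of_nat k ^ 3 * (1 / of_nat k :: rat)"
      by (simp add: power_numeral_reduce)
    have "harm_sum 1 (p - k) / of_nat (p - k) ^ 3 + harm_sum 1 k / of_nat k ^ 3 - 1 / of_nat k ^ 4 =
       harm_sum 1 (p - k) * (1 / of_nat (p - k) ^ 3 - (- 1) ^ 3 / of_nat k ^ 3)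
       - 1 / of_nat k ^ 3 * (harm_sum 1 (p - 1 - m) - harm_sum 1 m)"
      unfolding pm h x4 by (simp add: algebra_simps)
    also have "\<dots> \<in> I 1"
      using k m by (intro p_ideal_diff[OF p_ideal_mult_left p_ideal_mult_left] harm_sum_p_ideal inverse_power_p_ideal
          inverse_power_reflect_p_ideal harm_sum_1_reflect) auto
    finally show "harm_sum 1 (p - k) / of_nat (p - k) ^ 3 + harm_sum 1 k / of_nat k ^ 3 - 1 / of_nat k ^ 4 \<in> I 1" .
  qed
  finally show "?S + ?S \<in> I 1" .
qed

lemma sum_harm_sum_3_p_ideal: "(\<Sum>k=1..p-1. harm_sum 3 k / of_nat k) \<in> I 1"
proof -
  have "(\<Sum>k=1..p-1. harm_sum 3 k / of_nat k) =
      harm_sum 1 (p - 1) * harm_sum 3 (p - 1) + harm_sum 4 (p - 1) - (\<Sum>k=1..p-1. harm_sum 1 k / of_nat k ^ 3)"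
    using sum_harm_sum_1_3[of "p - 1"] by (simp add: algebra_simps)
  also have "\<dots> \<in> I 1"
    using p_ge7 by (intro p_ideal_diff p_ideal_add p_ideal_mult_left harm_sum_p_ideal harm_sum_4_p_ideal
      p_ideal_antimono[OF harm_sum_3_p_ideal] sum_harm_sum_1_cube_p_ideal) auto
  finally show ?thesis .
qed

lemma sum_harm_sum_2_square_p_ideal: "(\<Sum>k=1..p-1. harm_sum 2 k / of_nat k ^ 2) \<in> I 1"
proof -
  have "harm_sum 2 (p - 1) * harm_sum 2 (p - 1) \<in> I 1"
    using p_ge7 by (intro p_ideal_mult_left[OF harm_sum_p_ideal harm_sum_2_p_ideal]) simp
  then show ?thesis
    unfolding sum_harm_sum_2_divide
    using p_ideal_half'[OF p_ideal_add[OF _ harm_sum_4_p_ideal]] by (simp only: power2_eq_square)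
qed

end

subsection \<open>The Apery-like sum\<close>

context p_adic
begin

text \<open>The coefficient of p^2 is the second elementary symmetric sum of the \<open>a j\<close>,
  written through power sums, plus the sum of the \<open>b j\<close>.\<close>

lemma prod_expansion_p3:
  fixes a b :: "nat \<Rightarrow> rat" and k :: nat
  assumes p2: "p > 2" and ab: "\<And>j. j \<in> {1..k} \<Longrightarrow> a j \<in> I 0" "\<And>j. j \<in> {1..k} \<Longrightarrow> b j \<in> I 0"
  shows "(\<Prod>j=1..k. 1 + of_nat p * a j + of_nat p ^ 2 * b j) -
    (1 + of_nat p * (\<Sum>j=1..k. a j) + of_nat p ^ 2 *
      (((\<Sum>j=1..k. a j) ^ 2 - (\<Sum>j=1..k. a j ^ 2)) / 2 + (\<Sum>j=1..k. b j))) \<in> I 3"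
  using ab
proof (induction k)
  case 0
  then show ?case by (simp add: p_ideal_0)
next
  case (Suc k)
  define q :: rat where "q = of_nat p"
  define A A2 B where "A = (\<Sum>j=1..k. a j)" and "A2 = (\<Sum>j=1..k. a j ^ 2)" and "B = (\<Sum>j=1..k. b j)"
  define P where "P = (\<Prod>j=1..k. 1 + of_nat p * a j + of_nat p ^ 2 * b j)"
  define x y where "x = a (Suc k)" and "y = b (Suc k)"
  define C where "C = (A ^ 2 - A2) / 2 + B"
  have xy: "x \<in> I 0" "y \<in> I 0" using Suc.prems by (auto simp: x_def y_def)
  have AB: "A \<in> I 0" "A2 \<in> I 0" "B \<in> I 0"
    unfolding A_def A2_def B_def using Suc.prems by (auto intro!: p_ideal_sum p_ideal_power)
  then have C: "C \<in> I 0"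
    unfolding C_def by (intro p_ideal_add p_ideal_half p2 p_ideal_diff p_ideal_power)
  have q: "q \<in> I 0" unfolding q_def by (rule of_nat_p_ideal)
  have IH: "P - (1 + q * A + q ^ 2 * C) \<in> I 3"
    using Suc by (simp add: P_def A_def A2_def B_def C_def q_def)
  have "P * (1 + q * x + q ^ 2 * y) - (1 + q * (A + x) + q ^ 2 * (((A + x) ^ 2 - (A2 + x ^ 2)) / 2 + (B + y)))
      = (1 + q * x + q ^ 2 * y) * (P - (1 + q * A + q ^ 2 * C)) + q ^ 3 * (A * y + C * x + q * (C * y))"
    unfolding C_def by (simp add: field_simps power2_eq_square power3_eq_cube)
  also have "\<dots> \<in> I 3"
  proof (rule p_ideal_add)
    show "(1 + q * x + q ^ 2 * y) * (P - (1 + q * A + q ^ 2 * C)) \<in> I 3"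
      by (rule p_ideal_mult_left[OF _ IH])
        (intro p_ideal_add p_ideal_mult_left p_ideal_power one_p_ideal q xy)
    show "q ^ 3 * (A * y + C * x + q * (C * y)) \<in> I 3"
      unfolding q_def by (intro p_ideal_mult_right p_power_p_ideal p_ideal_add p_ideal_mult_left
        of_nat_p_ideal AB C xy)
  qed
  finally show ?case
    by (simp add: P_def A_def A2_def B_def x_def y_def q_def)
qed

text \<open>Going from k to k + 1 multiplies the binomial by (p-1-k)/(k+1) = -(1 - p/(k+1)).\<close>

lemma binomial_p_minus_1:
  "k < p \<Longrightarrow> (-1) ^ k * of_nat ((p - 1) choose k) = (\<Prod>j=1..k. 1 - of_nat p / of_nat j :: rat)"
proof (induction k)
  case (Suc k)
  have e: "of_nat (p - 1 - k) = (of_nat p - of_nat (Suc k) :: rat)"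
    using Suc.prems by (simp add: of_nat_diff)
  have "(of_nat (Suc k * ((p - 1) choose Suc k)) :: rat) = of_nat ((p - 1 - k) * ((p - 1) choose k))"
    using binomial_absorb_comp[of "p - 1" k] binomial_absorption[of k "p - 1"]
    by (metis mult.commute)
  then have "of_nat (Suc k) * of_nat ((p - 1) choose Suc k) = ((of_nat p - of_nat (Suc k)) * of_nat ((p - 1) choose k) :: rat)"
    using e by (simp only: of_nat_mult)
  then have "of_nat ((p - 1) choose Suc k) = ((of_nat p - of_nat (Suc k)) / of_nat (Suc k) * of_nat ((p - 1) choose k) :: rat)"
    by (simp add: field_simps del: of_nat_Suc)
  then have "(-1) ^ Suc k * of_nat ((p - 1) choose Suc k) =
      ((-1) ^ k * of_nat ((p - 1) choose k) * - ((of_nat p - of_nat (Suc k)) / of_nat (Suc k)) :: rat)"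
    by (simp del: of_nat_Suc)
  also have "- ((of_nat p - of_nat (Suc k)) / of_nat (Suc k)) = (1 - of_nat p / of_nat (Suc k) :: rat)"
    by (simp add: field_simps del: of_nat_Suc)
  finally show ?case using Suc by simp
qed simp

text \<open>The numerator p(p+1)...(p+k-1) is (p+1)...(p+k) times p/(p+k), which isolates the factor
  p.\<close>

lemma binomial_p_minus_1_add:
  "of_nat ((p - 1 + k) choose k) = (of_nat p / of_nat (p + k) * (\<Prod>j=1..k. 1 + of_nat p / of_nat j) :: rat)"
proof (induction k)
  case 0
  then show ?case using prime_gt_0_nat[OF p_prime] by simp
next
  case (Suc k)
  have p0: "p > 0" using prime_gt_0_nat[OF p_prime] .
  have "Suc k * (Suc (p - 1 + k) choose Suc k) = Suc (p - 1 + k) * ((p - 1 + k) choose k)"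
    by (rule Suc_times_binomial)
  also have "Suc (p - 1 + k) = p + k" using p0 by simp
  finally have "(of_nat (Suc k * (p + k choose Suc k)) :: rat) = of_nat ((p + k) * ((p - 1 + k) choose k))"
    by (simp only:)
  moreover have "p - 1 + Suc k = p + k" using p0 by simp
  ultimately have "(of_nat (p - 1 + Suc k choose Suc k) :: rat) = of_nat (p + k) / of_nat (Suc k) * of_nat ((p - 1 + k) choose k)"
    by (simp only: of_nat_mult) (simp add: field_simps del: of_nat_Suc of_nat_add)
  also have "\<dots> = of_nat p / of_nat (Suc k) * (\<Prod>j=1..k. 1 + of_nat p / of_nat j)"
    unfolding Suc using p0 by (simp del: of_nat_Suc of_nat_add)
  also have "of_nat p / of_nat (Suc k) = (of_nat p / of_nat (p + Suc k) * (1 + of_nat p / of_nat (Suc k)) :: rat)"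
  proof -
    have "q / s = q / (q + s) * (1 + q / s)" if "s \<noteq> 0" "q + s \<noteq> 0" for q s :: rat
    proof -
      have "1 + q / s = (q + s) / s" using that by (simp add: add_divide_distrib)
      then show ?thesis using that by simp
    qed
    then show ?thesis
      by (metis add_is_0 nat.distinct(2) of_nat_add of_nat_eq_0_iff)
  qed
  finally show ?case by (simp add: mult_ac)
qed

end

section \<open>Reduction of the sum to harmonic sums modulo p^3\<close>

context p_adic_ge7
begin

abbreviation "H \<equiv> harm_sum"

lemma alternating_binomial_cong:
  assumes "k < p"
  shows "(-1) ^ k * of_nat ((p - 1) choose k) -
     (1 - of_nat p * H 1 k + of_nat p ^ 2 * ((H 1 k ^ 2 - H 2 k) / 2)) \<in> I 3"
proof -
  have "(\<Prod>j=1..k. 1 + of_nat p * (- 1 / of_nat j) + of_nat p ^ 2 * 0) -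
    (1 + of_nat p * (\<Sum>j=1..k. - 1 / of_nat j) + of_nat p ^ 2 *
      (((\<Sum>j=1..k. - 1 / of_nat j) ^ 2 - (\<Sum>j=1..k. (- 1 / of_nat j) ^ 2)) / 2 + (\<Sum>j=1..k. 0))) \<in> I 3"
    using assms p_ideal_uminus[OF inverse_p_ideal]
    by (intro prod_expansion_p3 p_gt2 p_ideal_0) auto
  then show ?thesis
    using binomial_p_minus_1[OF assms] by (simp add: harm_sum_def sum_negf power_divide)
qed

text \<open>For k < p, what remains of (-1)^k C(p-1,k) C(p-1+k,k)^2 once (p/(p+k))^2 is split
  off.\<close>

definition "apery_prod k = (\<Prod>j=1..k. (1 - of_nat p / of_nat j) * (1 + of_nat p / of_nat j) ^ 2 :: rat)"

lemma apery_prod_cong: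
  assumes "k < p"
  shows "apery_prod k - (1 + of_nat p * H 1 k + of_nat p ^ 2 * ((H 1 k ^ 2 - 3 * H 2 k) / 2)) \<in> I 3"
proof -
  \<comment> \<open>Since (1 - x)(1 + x)^2 = 1 + x - x^2 - x^3, this choice with x = p/j matches
    each factor exactly.\<close>
  let ?b = "\<lambda>j. - (1 / of_nat j ^ 2) - of_nat p * (1 / of_nat j ^ 3) :: rat"
  have "(\<Prod>j=1..k. 1 + of_nat p * (1 / of_nat j) + of_nat p ^ 2 * ?b j) -
    (1 + of_nat p * (\<Sum>j=1..k. 1 / of_nat j) + of_nat p ^ 2 *
      (((\<Sum>j=1..k. 1 / of_nat j) ^ 2 - (\<Sum>j=1..k. (1 / of_nat j) ^ 2)) / 2 + (\<Sum>j=1..k. ?b j))) \<in> I 3"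
    (is "?P - ?E \<in> _")
    using assms inverse_power_p_ideal
    by (intro prod_expansion_p3 p_gt2 inverse_p_ideal p_ideal_diff p_ideal_uminus p_ideal_mult_left of_nat_p_ideal) auto
  moreover have P: "?P = apery_prod k"
    unfolding apery_prod_def
  proof (intro prod.cong refl)
    fix j
    have "1 + u * v + u ^ 2 * (- (v ^ 2) - u * v ^ 3) = (1 - u * v) * (1 + u * v) ^ 2" for u v :: rat
      by (simp add: algebra_simps power2_eq_square power3_eq_cube)
    from this[of "of_nat p" "1 / of_nat j"]
    show "1 + of_nat p * (1 / of_nat j) + of_nat p ^ 2 * ?b j = (1 - of_nat p / of_nat j) * (1 + of_nat p / of_nat j) ^ 2"
      by (simp add: power_divide)
  qed
  moreover have E: "?E = 1 + of_nat p * H 1 k + of_nat p ^ 2 * ((H 1 k ^ 2 - 3 * H 2 k) / 2) - of_nat p ^ 3 * H 3 k"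
  proof -
    have "(\<Sum>j=1..k. ?b j) = - H 2 k - of_nat p * H 3 k"
      by (simp add: harm_sum_def sum_negf sum_subtractf sum_distrib_left)
    moreover have "(\<Sum>j=1..k. (1 / of_nat j) ^ 2) = H 2 k" "(\<Sum>j=1..k. 1 / of_nat j) = H 1 k"
      by (simp_all add: harm_sum_def power_divide)
    ultimately show ?thesis
      by (simp only:) (simp add: field_simps power2_eq_square power3_eq_cube)
  qed
  ultimately have D: "apery_prod k - (1 + of_nat p * H 1 k + of_nat p ^ 2 * ((H 1 k ^ 2 - 3 * H 2 k) / 2) - of_nat p ^ 3 * H 3 k) \<in> I 3"
    unfolding P E by simp
  have "of_nat p ^ 3 * H 3 k \<in> I 3"
    using assms by (intro p_ideal_mult_right p_power_p_ideal harm_sum_p_ideal)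
  from p_ideal_diff[OF D this] show ?thesis by (simp add: algebra_simps)
qed

text \<open>The binomial series of (k + p)^(-2). With x = p/k, (1 + x)^2 (1 - 2x + 3x^2) = 1 + 4x^3
  + 3x^4, so the error has order p^3.\<close>

lemma inverse_square_shift_cong:
  assumes "0 < k" "k < p"
  shows "1 / of_nat (p + k) ^ 2 - (1 / of_nat k ^ 2 - of_nat p * (2 / of_nat k ^ 3) + of_nat p ^ 2 * (3 / of_nat k ^ 4)) \<in> I 3"
proof -
  define u v w :: rat where "u = of_nat p" and "v = 1 / of_nat k" and "w = 1 / of_nat (p + k)"
  have "\<not> p dvd p + k" using not_p_dvd_less[OF assms] by simp
  then have wi: "w \<in> I 0" unfolding w_def by (rule inverse_of_nat_p_ideal)
  have vi: "v \<in> I 0" unfolding v_def by (intro inverse_p_ideal assms)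
  have wv: "v = w * (1 + u * v)"
    unfolding u_def v_def w_def using assms by (simp add: field_simps)
  have "w ^ 2 - (v ^ 2 - u * (2 * v ^ 3) + u ^ 2 * (3 * v ^ 4)) =
      w ^ 2 * (1 - (1 + u * v) ^ 2 * (1 - 2 * (u * v) + 3 * (u * v) ^ 2))"
  proof -
    have "v ^ 2 - u * (2 * v ^ 3) + u ^ 2 * (3 * v ^ 4) = v ^ 2 * (1 - 2 * (u * v) + 3 * (u * v) ^ 2)"
      by (simp add: algebra_simps power2_eq_square power3_eq_cube power4_eq_xxxx)
    moreover have "v ^ 2 = w ^ 2 * (1 + u * v) ^ 2" using wv by (metis power_mult_distrib)
    ultimately have e: "v ^ 2 - u * (2 * v ^ 3) + u ^ 2 * (3 * v ^ 4) =
        w ^ 2 * (1 + u * v) ^ 2 * (1 - 2 * (u * v) + 3 * (u * v) ^ 2)" by metis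
    show ?thesis unfolding e by (simp only: right_diff_distrib mult.assoc mult_1_right)
  qed
  also have "\<dots> = - (u ^ 3 * (w ^ 2 * (4 * v ^ 3 + 3 * (u * v ^ 4))))"
    by (simp add: algebra_simps power2_eq_square power3_eq_cube power4_eq_xxxx)
  also have "\<dots> \<in> I 3"
    unfolding u_def by (intro p_ideal_uminus p_ideal_mult_right p_power_p_ideal p_ideal_mult_left p_ideal_add
        p_ideal_power of_nat_p_ideal numeral_p_ideal vi wi)
  finally show ?thesis by (simp add: u_def v_def w_def power_divide)
qed

text \<open>The quantity T of the outline.\<close>

definition "apery_tail = (\<Sum>k=1..p-1. 1 / of_nat (p + k) ^ 2 * apery_prod k)"

lemma atMost_p_minus_1: "{..p - 1} = insert 0 {1..p - 1}"
  by auto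

lemma apery_eq_tail:
  "of_nat (\<Sum>k=0..p-1. ((p-1) choose k)^2 * ((p-1+k) choose k)) = 1 + of_nat p ^ 2 * apery_tail"
proof -
  have "(of_nat (\<Sum>k=0..p-1. ((p-1) choose k)^2 * ((p-1+k) choose k)) :: rat) =
      (-1) ^ (p - 1) * (\<Sum>k\<le>p-1. (-1) ^ k * of_nat ((p - 1) choose k) * of_nat ((p - 1 + k) choose k) ^ 2)"
    unfolding atLeast0AtMost by (rule apery_sum_eq_alternating)
  also have "(-1 :: rat) ^ (p - 1) = 1" using odd_p by simp
  also have "(\<Sum>k\<le>p-1. (-1) ^ k * of_nat ((p - 1) choose k) * of_nat ((p - 1 + k) choose k) ^ 2) =
      1 + (\<Sum>k=1..p-1. (-1) ^ k * of_nat ((p - 1) choose k) * of_nat ((p - 1 + k) choose k) ^ 2 :: rat)"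
    unfolding atMost_p_minus_1 by (subst sum.insert) auto
  also have "(\<Sum>k=1..p-1. (-1) ^ k * of_nat ((p - 1) choose k) * of_nat ((p - 1 + k) choose k) ^ 2 :: rat)
      = of_nat p ^ 2 * apery_tail"
    unfolding apery_tail_def sum_distrib_left
  proof (intro sum.cong refl)
    fix k assume "k \<in> {1..p-1}"
    then have k: "k < p" by auto
    have "(-1) ^ k * of_nat ((p - 1) choose k) * of_nat ((p - 1 + k) choose k) ^ 2 =
       (of_nat p / of_nat (p + k)) ^ 2 * ((\<Prod>j=1..k. 1 - of_nat p / of_nat j) * (\<Prod>j=1..k. 1 + of_nat p / of_nat j :: rat) ^ 2)"
      unfolding binomial_p_minus_1[OF k] binomial_p_minus_1_add power_mult_distrib by (simp only: mult_ac)
    also have "(\<Prod>j=1..k. 1 - of_nat p / of_nat j) * (\<Prod>j=1..k. 1 + of_nat p / of_nat j :: rat) ^ 2 = apery_prod k"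
      by (simp only: apery_prod_def prod.distrib prod_power_distrib)
    finally show "(-1) ^ k * of_nat ((p - 1) choose k) * of_nat ((p - 1 + k) choose k) ^ 2 =
        of_nat p ^ 2 * (1 / of_nat (p + k) ^ 2 * apery_prod k)"
      by (simp add: power_divide del: of_nat_add)
  qed
  finally show ?thesis by simp
qed

text \<open>In these names the last digit is the power of k and what precedes it describes the
  harmonic factor, \<open>1sq\<close> meaning H_1 squared.\<close>

abbreviation "S22 \<equiv> \<Sum>k=1..p-1. H 2 k / of_nat k ^ 2"
abbreviation "S13 \<equiv> \<Sum>k=1..p-1. H 1 k / of_nat k ^ 3"
abbreviation "S1sq2 \<equiv> \<Sum>k=1..p-1. H 1 k ^ 2 / of_nat k ^ 2"
abbreviation "S12 \<equiv> \<Sum>k=1..p-1. H 1 k / of_nat k ^ 2"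

text \<open>The signed binomial coefficients in the nested identity are 1 modulo p, so they can be dropped.\<close>

lemma S1sq2_p_ideal: "S1sq2 \<in> I 1"
proof -
  define a where "a = (\<lambda>k. (H 1 k ^ 2 + H 2 k) / 2 / of_nat k ^ 2)"
  have "alt_binom_sum a (p - 1) = (\<Sum>k=1..p-1. (-1) ^ k * of_nat ((p - 1) choose k) * a k)"
    unfolding alt_binom_sum_def atMost_p_minus_1 by (subst sum.insert) (auto simp: a_def)
  then have "(\<Sum>k=1..p-1. a k) = alt_binom_sum a (p - 1)
      - (\<Sum>k=1..p-1. ((-1) ^ k * of_nat ((p - 1) choose k) - 1) * a k)"
    by (simp add: sum_subtractf algebra_simps)
  also have "\<dots> \<in> I 1"
  proof (intro p_ideal_diff p_ideal_sum)
    show "alt_binom_sum a (p - 1) \<in> I 1"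
      unfolding a_def alt_binom_sum_nested by (intro p_ideal_uminus sum_harm_sum_3_p_ideal)
    fix k assume "k \<in> {1..p-1}"
    then have k: "0 < k" "k < p" by auto
    have "(H 1 k ^ 2 + H 2 k) / 2 * (1 / of_nat k ^ 2) \<in> I 0"
      by (intro p_ideal_mult_left p_ideal_half' p_ideal_add p_ideal_power harm_sum_p_ideal inverse_power_p_ideal k)
    then have a: "a k \<in> I 0" by (simp add: a_def)
    let ?h = "(H 1 k ^ 2 - H 2 k) / 2"
    have h: "?h \<in> I 0"
      by (intro p_ideal_half' p_ideal_diff p_ideal_power harm_sum_p_ideal k)
    have "(-1) ^ k * of_nat ((p - 1) choose k) - 1 =
      ((-1) ^ k * of_nat ((p - 1) choose k) - (1 - of_nat p * H 1 k + of_nat p ^ 2 * ?h))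
       + of_nat p * (of_nat p * ?h - H 1 k)"
      by (simp add: algebra_simps power2_eq_square)
    also have "\<dots> \<in> I 1"
      by (intro p_ideal_add p_ideal_antimono[OF alternating_binomial_cong[OF k(2)]] p_ideal_mult_right[OF p_p_ideal]
        p_ideal_diff p_ideal_mult_left of_nat_p_ideal h harm_sum_p_ideal k) simp
    finally show "((-1) ^ k * of_nat ((p - 1) choose k) - 1) * a k \<in> I 1"
      using a by (rule p_ideal_mult_right)
  qed
  finally have "2 * (\<Sum>k=1..p-1. a k) - S22 \<in> I 1"
    by (intro p_ideal_diff p_ideal_mult_left[OF numeral_p_ideal] sum_harm_sum_2_square_p_ideal)
  moreover have "2 * (\<Sum>k=1..p-1. a k) = S1sq2 + S22"
    unfolding sum_distrib_left sum.distrib[symmetric] a_def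
    by (intro sum.cong refl) (simp add: add_divide_distrib)
  ultimately show ?thesis by simp
qed

text \<open>The factor 3/2 is 1 + 1/2: H_2 comes from the leading 1 of the signed binomial, and
  H_2/2 from the closed form of the alternating sum. H_1^2 drops out, being divisible by
  p^4.\<close>

lemma S12_cong: "of_nat p * S12 - (3 / 2 * H 2 (p - 1) + of_nat p ^ 2 * ((S1sq2 - S22) / 2)) \<in> I 3"
proof -
  let ?R = "\<lambda>k. 1 - of_nat p * H 1 k + of_nat p ^ 2 * ((H 1 k ^ 2 - H 2 k) / 2)"
  have "alt_binom_sum (\<lambda>k. 1 / of_nat k ^ 2) (p - 1) = (\<Sum>k=1..p-1. (-1) ^ k * of_nat ((p - 1) choose k) * (1 / of_nat k ^ 2) :: rat)"
    unfolding alt_binom_sum_def atMost_p_minus_1 by (subst sum.insert) auto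
  then have e: "(\<Sum>k=1..p-1. (-1) ^ k * of_nat ((p - 1) choose k) * (1 / of_nat k ^ 2) :: rat)
      = - (H 1 (p - 1) ^ 2 + H 2 (p - 1)) / 2"
    by (simp only: alt_binom_sum_inverse_square)
  have "(\<Sum>k=1..p-1. ((-1) ^ k * of_nat ((p - 1) choose k) - ?R k) * (1 / of_nat k ^ 2)) \<in> I 3"
    by (intro p_ideal_sum p_ideal_mult_right alternating_binomial_cong inverse_power_p_ideal) auto
  also have "(\<Sum>k=1..p-1. ((-1) ^ k * of_nat ((p - 1) choose k) - ?R k) * (1 / of_nat k ^ 2)) =
    - (H 1 (p - 1) ^ 2 + H 2 (p - 1)) / 2 - (\<Sum>k=1..p-1. ?R k * (1 / of_nat k ^ 2))"
    unfolding left_diff_distrib sum_subtractf e ..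
  also have "(\<Sum>k=1..p-1. ?R k * (1 / of_nat k ^ 2)) =
      (\<Sum>k=1..p-1. 1 / of_nat k ^ 2 - of_nat p * (H 1 k / of_nat k ^ 2)
        + of_nat p ^ 2 / 2 * (H 1 k ^ 2 / of_nat k ^ 2 - H 2 k / of_nat k ^ 2))"
    by (intro sum.cong refl) (simp add: algebra_simps diff_divide_distrib)
  also have "\<dots> = H 2 (p - 1) - of_nat p * S12 + of_nat p ^ 2 / 2 * (S1sq2 - S22)"
    by (simp only: sum.distrib sum_subtractf sum_distrib_left[symmetric] harm_sum_def)
  finally have D: "- (H 1 (p - 1) ^ 2 + H 2 (p - 1)) / 2 - (H 2 (p - 1) - of_nat p * S12 + of_nat p ^ 2 / 2 * (S1sq2 - S22)) \<in> I 3" .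
  have "H 1 (p - 1) ^ 2 / 2 \<in> I 3"
    using p_ideal_half'[OF p_ideal_antimono[OF p_ideal_mult[OF harm_sum_1_p_ideal harm_sum_1_p_ideal], of 3]]
    by (simp add: power2_eq_square)
  from p_ideal_add[OF D this] show ?thesis
    by (simp add: algebra_simps add_divide_distrib diff_divide_distrib)
qed

lemma apery_tail_expansion:
  "apery_tail - (H 2 (p - 1) + of_nat p * (S12 - 2 * H 3 (p - 1))
     + of_nat p ^ 2 * (3 * H 4 (p - 1) - 2 * S13 + (S1sq2 - 3 * S22) / 2)) \<in> I 3"
proof -
  let ?t = "\<lambda>k. 1 / of_nat k ^ 2 + of_nat p * (H 1 k / of_nat k ^ 2 - 2 * (1 / of_nat k ^ 3))
     + of_nat p ^ 2 * (3 * (1 / of_nat k ^ 4) - 2 * (H 1 k / of_nat k ^ 3)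
        + (H 1 k ^ 2 / of_nat k ^ 2 - 3 * (H 2 k / of_nat k ^ 2)) / 2)"
  have "apery_tail - (\<Sum>k=1..p-1. ?t k) = (\<Sum>k=1..p-1. 1 / of_nat (p + k) ^ 2 * apery_prod k - ?t k)"
    by (simp only: apery_tail_def sum_subtractf)
  also have "\<dots> \<in> I 3"
  proof (rule p_ideal_sum)
    fix k assume "k \<in> {1..p-1}"
    then have k: "0 < k" "k < p" by auto
    define u v h g w Q :: rat where "u = of_nat p" and "v = 1 / of_nat k" and "h = H 1 k"
      and "g = (H 1 k ^ 2 - 3 * H 2 k) / 2" and "w = 1 / of_nat (p + k) ^ 2" and "Q = apery_prod k"
    have vi: "v \<in> I 0" and hi: "h \<in> I 0" and gi: "g \<in> I 0" and ui: "u \<in> I 0"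
      unfolding u_def v_def h_def g_def
      by (intro inverse_p_ideal harm_sum_p_ideal k p_ideal_half' p_ideal_diff p_ideal_power
          p_ideal_mult_left numeral_p_ideal of_nat_p_ideal)+
    have D1: "Q - (1 + u * h + u ^ 2 * g) \<in> I 3"
      using apery_prod_cong[OF k(2)] by (simp add: Q_def u_def h_def g_def)
    have D2: "w - (v ^ 2 - u * (2 * v ^ 3) + u ^ 2 * (3 * v ^ 4)) \<in> I 3"
      using inverse_square_shift_cong[OF k] by (simp add: w_def u_def v_def power_divide)
    have "\<not> p dvd p + k" using not_p_dvd_less[OF k] by simp
    then have wi: "w \<in> I 0"
      using p_ideal_power[OF inverse_of_nat_p_ideal, of "p + k" 2] unfolding w_def by (simp add: power_divide)
    have "?t k = v ^ 2 + u * (h * v ^ 2 - 2 * v ^ 3) + u ^ 2 * (3 * v ^ 4 - 2 * (h * v ^ 3) + g * v ^ 2)"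
      by (simp add: u_def v_def h_def g_def power_divide diff_divide_distrib)
    \<comment> \<open>The error of each factor times the other, plus the overflow of order p^3 from
      multiplying the two truncated expansions.\<close>
    then have "w * Q - ?t k = w * (Q - (1 + u * h + u ^ 2 * g))
        + (1 + u * h + u ^ 2 * g) * (w - (v ^ 2 - u * (2 * v ^ 3) + u ^ 2 * (3 * v ^ 4)))
        + u ^ 3 * (h * (3 * v ^ 4) - g * (2 * v ^ 3) + u * (g * (3 * v ^ 4)))"
      by (simp add: algebra_simps power2_eq_square power3_eq_cube)
    also have "\<dots> \<in> I 3"
    proof (intro p_ideal_add)
      show "w * (Q - (1 + u * h + u ^ 2 * g)) \<in> I 3" using wi D1 by (rule p_ideal_mult_left)
      show "(1 + u * h + u ^ 2 * g) * (w - (v ^ 2 - u * (2 * v ^ 3) + u ^ 2 * (3 * v ^ 4))) \<in> I 3"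
        by (rule p_ideal_mult_left[OF _ D2])
          (intro p_ideal_add p_ideal_mult_left p_ideal_power one_p_ideal ui hi gi)
      show "u ^ 3 * (h * (3 * v ^ 4) - g * (2 * v ^ 3) + u * (g * (3 * v ^ 4))) \<in> I 3"
        unfolding u_def by (intro p_ideal_mult_right p_power_p_ideal p_ideal_add p_ideal_diff p_ideal_mult_left
          of_nat_p_ideal numeral_p_ideal p_ideal_power vi hi gi)
    qed
    finally show "1 / of_nat (p + k) ^ 2 * apery_prod k - ?t k \<in> I 3"
      by (simp only: w_def Q_def)
  qed
  also have "(\<Sum>k=1..p-1. ?t k) = H 2 (p - 1) + of_nat p * (S12 - 2 * H 3 (p - 1))
     + of_nat p ^ 2 * (3 * H 4 (p - 1) - 2 * S13 + (S1sq2 - 3 * S22) / 2)"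
    by (simp only: sum.distrib sum_subtractf sum_distrib_left[symmetric] sum_divide_distrib[symmetric] harm_sum_def)
  finally show ?thesis .
qed

text \<open>5/2 = 1 + 3/2: H_2 occurs directly and through p \<open>S12\<close>. All terms with p^2
  combine to p^2 \<open>W\<close>, and every sum in \<open>W\<close> vanishes modulo p.\<close>

lemma apery_tail_cong: "apery_tail - 5 / 2 * H 2 (p - 1) \<in> I 3"
proof -
  define W where "W = 3 * H 4 (p - 1) - 2 * S13 + S1sq2 - 2 * S22"
  have W: "W \<in> I 1"
    unfolding W_def
    by (intro p_ideal_diff p_ideal_add p_ideal_mult_left[OF numeral_p_ideal] harm_sum_4_p_ideal S1sq2_p_ideal
        sum_harm_sum_1_cube_p_ideal sum_harm_sum_2_square_p_ideal)
  have pW: "of_nat p ^ 2 * W \<in> I 3"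
    using p_power_mult_p_ideal[OF W, of 2] by simp
  have pH: "2 * (of_nat p * H 3 (p - 1)) \<in> I 3"
    by (intro p_ideal_mult_left numeral_p_ideal p_ideal_mult_1_2 p_p_ideal harm_sum_3_p_ideal)
  have "apery_tail - 5 / 2 * H 2 (p - 1) =
    (apery_tail - (H 2 (p - 1) + of_nat p * (S12 - 2 * H 3 (p - 1))
     + of_nat p ^ 2 * (3 * H 4 (p - 1) - 2 * S13 + (S1sq2 - 3 * S22) / 2)))
    + (of_nat p * S12 - (3 / 2 * H 2 (p - 1) + of_nat p ^ 2 * ((S1sq2 - S22) / 2)))
    + of_nat p ^ 2 * W - 2 * (of_nat p * H 3 (p - 1))"
    unfolding W_def by (simp add: field_simps)
  also have "\<dots> \<in> I 3"
    by (rule p_ideal_diff[OF p_ideal_add[OF p_ideal_add[OF apery_tail_expansion S12_cong] pW] pH])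
  finally show ?thesis .
qed

text \<open>Multiplying 4/3, 1/2 and 1/9 by 5/2 gives 10/3, 5/4 and 5/18; the factor p^2 in front of
  T raises the modulus from p^3 to p^5.\<close>

lemma apery_cong:
  "of_nat (\<Sum>k=0..p-1. ((p-1) choose k)^2 * ((p-1+k) choose k)) -
    (1 + of_nat p ^ 3 * (10/3 * bernoulli (p-3) - 5/4 * bernoulli (2*p-4))
              + 5/18 * of_nat p ^ 4 * bernoulli (p-3)) \<in> I 5"
proof -
  let ?D1 = "apery_tail - 5 / 2 * H 2 (p - 1)"
  let ?D2 = "H 2 (p - 1) - (of_nat p * (4 / 3 * bernoulli (p - 3) - bernoulli (2 * p - 4) / 2)
     + of_nat p ^ 2 * bernoulli (p - 3) / 9)"
  have "of_nat (\<Sum>k=0..p-1. ((p-1) choose k)^2 * ((p-1+k) choose k)) -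
    (1 + of_nat p ^ 3 * (10/3 * bernoulli (p-3) - 5/4 * bernoulli (2*p-4))
              + 5/18 * of_nat p ^ 4 * bernoulli (p-3)) = of_nat p ^ 2 * (?D1 + 5 * ?D2 / 2)"
    unfolding apery_eq_tail by (simp add: field_simps power_numeral_reduce)
  also have "\<dots> \<in> I (2 + 3)"
    by (intro p_power_mult_p_ideal p_ideal_add apery_tail_cong p_ideal_half' p_ideal_mult_left[OF numeral_p_ideal]
        harm_sum_2_cong_bernoulli)
  finally show ?thesis by simp
qed

end

theorem theorem1p2:
  fixes p :: nat
  assumes "prime p" and "p \<ge> 7"
  shows "rat_cong_pow
           (of_nat (\<Sum>k=0..p-1. ((p-1) choose k)^2 * ((p-1+k) choose k)))
           (1 + of_nat p ^ 3 * (10/3 * bernoulli (p-3) - 5/4 * bernoulli (2*p-4))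
              + 5/18 * of_nat p ^ 4 * bernoulli (p-3))
           p 5"
proof -
  interpret p_adic_ge7 p using assms by unfold_locales
  show ?thesis unfolding rat_cong_pow_iff by (rule apery_cong)
qed

end
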